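(* Let $n\geq1$. For every automorphism $h$ of the Lie ball $L_n$ there exists an automorphism $F\in{\sf Aut}(\mathbb L_{n+1})$ extending $h$ on the locus set $\{0\}\times L_n\subset\mathbb L_{n+1}$, i.e. $F(0,z')=(0,h(z'))$ for all $z'\in L_n$.
   Context: $L_m:=\{z\in\mathbb C^m:\|z\|<1,\ \sqrt{\|z\|^4-|\sum_jz_j^2|^2}<1-\|z\|^2\}$ with $\|z\|^2=\sum_j|z_j|^2$ (so $L_1$ is the unit disc). $\Lambda_{m}(z)=(z_1^2,z_2,\dots,z_m)$ and $\mathbb L_m:=\Lambda_m(L_m)$. The locus set of $\Lambda_{n+1}$ is $\{z\in L_{n+1}:\det\Lambda_{n+1}'(z)=0\}=\{0\}\times L_n$, and $\Lambda_{n+1}$ maps it identically onto $\{0\}\times L_n\subset\mathbb L_{n+1}$. *)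

theory Defs
  imports "HOL-Analysis.Analysis"
begin

text \<open>C^m is modelled as complex ^ 'm for a finite index type 'm (m = CARD('m)).
  C^(n+1) is modelled as complex ^ ('n option), the coordinate None being the
  first coordinate z_1 and Some j the remaining ones.\<close>

definition sqnorm :: "complex ^ 'm::finite \<Rightarrow> real" where
  "sqnorm z = (\<Sum>j\<in>UNIV. (cmod (z $ j))^2)"

definition lie_ball :: "(complex ^ 'm::finite) set" where
  "lie_ball = {z. sqnorm z < 1 \<and>
      sqrt ((sqnorm z)^2 - (cmod (\<Sum>j\<in>UNIV. (z $ j)^2))^2) < 1 - sqnorm z}"

definition holo_on :: "(complex ^ 'm::finite \<Rightarrow> complex ^ 'k::finite) \<Rightarrow> (complex ^ 'm) set \<Rightarrow> bool" where
  "holo_on f S \<longleftrightarrow> (\<forall>z\<in>S. \<exists>L. (f has_derivative L) (at z) \<and> (\<forall>v. L (\<i> *s v) = \<i> *s L v))"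

definition aut :: "(complex ^ 'm::finite) set \<Rightarrow> (complex ^ 'm \<Rightarrow> complex ^ 'm) set" where
  "aut S = {f. bij_betw f S S \<and> holo_on f S \<and> holo_on (the_inv_into S f) S}"

definition Lambda_map :: "complex ^ ('n::finite option) \<Rightarrow> complex ^ ('n option)" where
  "Lambda_map z = (\<chi> i. case i of None \<Rightarrow> (z $ None)^2 | Some j \<Rightarrow> z $ Some j)"

definition LL :: "(complex ^ ('n::finite option)) set" where
  "LL = Lambda_map ` lie_ball"

definition embed0 :: "complex ^ 'n::finite \<Rightarrow> complex ^ ('n option)" where
  "embed0 z = (\<chi> i. case i of None \<Rightarrow> 0 | Some j \<Rightarrow> z $ j)"

end

theory Submission
  imports Defs "HOL-Complex_Analysis.Conformal_Mappings"
begin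

text \<open>
  Call an automorphism of \<open>L\<^sub>n\<close> liftable if it is the restriction of an automorphism of
  \<open>\<bbbL>\<^sub>n\<^sub>+\<^sub>1\<close> to the locus set; liftable automorphisms are closed under composition and inversion.
  On homogeneous coordinates \<open>[1 : z : z\<bullet>z]\<close> the group \<open>O(2,n)\<close> acts by automorphisms of \<open>L\<^sub>n\<close>, and
  embedded into \<open>O(2,n+1)\<close> it commutes with \<open>z\<^sub>1 \<mapsto> -z\<^sub>1\<close>, so it descends to \<open>\<bbbL>\<^sub>n\<^sub>+\<^sub>1\<close>. The Lorentz boosts
  in this group, together with the multiplications by unimodular scalars, already act transitively
  on \<open>L\<^sub>n\<close>, which leaves the automorphisms \<open>f\<close> with \<open>f 0 = 0\<close>.

  For these, let \<open>A = f' 0\<close>. The Schwarz lemma in real unit directions bounds the columns of both \<open>A\<close>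
  and its inverse by \<open>1\<close>, which forces \<open>A\<close> to be unitary; then equality holds in the Schwarz lemma, so
  that \<open>f\<close> agrees with \<open>A\<close> at all real points and hence everywhere. A unitary \<open>A\<close> preserving \<open>L\<^sub>n\<close> preserves
  \<open>|z\<bullet>z|\<close>, hence multiplies \<open>z\<bullet>z\<close> by a unimodular constant \<open>\<kappa>\<close>, and \<open>(w\<^sub>1, w') \<mapsto> (\<kappa> w\<^sub>1, A w')\<close> is a lift.
\<close>

section \<open>Holomorphic functions of several variables\<close>

text \<open>Scalar counterpart of \<open>holo_on\<close>. Complex-valued functions have products and
  quotients, so the closure rules are proved here and carried over to maps by
  \<open>holo_on_componentwise\<close>.\<close>

definition hol_at :: "(complex ^ 'm::finite \<Rightarrow> complex) \<Rightarrow> complex ^ 'm \<Rightarrow> bool" where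
  "hol_at f z \<longleftrightarrow> (\<exists>L. (f has_derivative L) (at z) \<and> (\<forall>v. L (\<i> *s v) = \<i> * L v))"

lemma hol_at_const [simp]: "hol_at (\<lambda>_. c) z"
  unfolding hol_at_def by (rule exI[of _ "\<lambda>_. 0"]) auto

lemma has_derivative_nth: "(f has_derivative L) F \<Longrightarrow> ((\<lambda>z. f z $ j) has_derivative (\<lambda>v. L v $ j)) F"
  by (rule bounded_linear.has_derivative[OF bounded_linear_vec_nth])

lemma hol_at_nth [simp]: "hol_at (\<lambda>z. z $ j) z"
  unfolding hol_at_def
  by (rule exI[of _ "\<lambda>v. v $ j"]) (auto intro!: bounded_linear_imp_has_derivative bounded_linear_vec_nth)

lemma hol_at_add: "hol_at f z \<Longrightarrow> hol_at g z \<Longrightarrow> hol_at (\<lambda>z. f z + g z) z"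
  unfolding hol_at_def by (metis (mono_tags, lifting) distrib_left has_derivative_add)

lemma hol_at_diff: "hol_at f z \<Longrightarrow> hol_at g z \<Longrightarrow> hol_at (\<lambda>z. f z - g z) z"
  unfolding hol_at_def by (metis (mono_tags, lifting) right_diff_distrib has_derivative_diff)

lemma hol_at_mult:
  assumes "hol_at f z" "hol_at g z"
  shows "hol_at (\<lambda>z. f z * g z) z"
proof -
  obtain L M where "(f has_derivative L) (at z)" "\<And>v. L (\<i> *s v) = \<i> * L v"
    "(g has_derivative M) (at z)" "\<And>v. M (\<i> *s v) = \<i> * M v"
    using assms by (auto simp: hol_at_def)
  then show ?thesis
    unfolding hol_at_def
    by (intro exI[of _ "\<lambda>v. f z * M v + L v * g z"]) (auto simp: distrib_left mult_ac intro!: derivative_eq_intros)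
qed

lemma hol_at_sum: "(\<And>j. j \<in> A \<Longrightarrow> hol_at (f j) z) \<Longrightarrow> hol_at (\<lambda>z. \<Sum>j\<in>A. f j z) z"
  by (induction A rule: infinite_finite_induct) (auto intro: hol_at_add)

lemma hol_at_inverse:
  assumes "hol_at f z" "f z \<noteq> 0"
  shows "hol_at (\<lambda>z. inverse (f z)) z"
proof -
  obtain L where "(f has_derivative L) (at z)" "\<And>v. L (\<i> *s v) = \<i> * L v"
    using assms by (auto simp: hol_at_def)
  then show ?thesis
    unfolding hol_at_def using assms(2)
    by (intro exI[of _ "\<lambda>v. - (inverse (f z) * L v * inverse (f z))"]) auto
qed

lemma hol_at_divide: "hol_at f z \<Longrightarrow> hol_at g z \<Longrightarrow> g z \<noteq> 0 \<Longrightarrow> hol_at (\<lambda>z. f z / g z) z"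
  using hol_at_mult[OF _ hol_at_inverse] by (simp add: divide_inverse)

lemma hol_at_power: "hol_at f z \<Longrightarrow> hol_at (\<lambda>z. f z ^ n) z"
  by (induction n) (auto intro: hol_at_mult)

lemmas hol_at_intros = hol_at_add hol_at_diff hol_at_mult hol_at_sum hol_at_divide hol_at_power

lemma holo_on_componentwise: "holo_on f S \<longleftrightarrow> (\<forall>z\<in>S. \<forall>j. hol_at (\<lambda>z. f z $ j) z)"
proof
  assume L: "holo_on f S"
  show "\<forall>z\<in>S. \<forall>j. hol_at (\<lambda>z. f z $ j) z"
  proof (intro ballI allI)
    fix z j assume "z \<in> S"
    then obtain L where "(f has_derivative L) (at z)" "\<And>v. L (\<i> *s v) = \<i> *s L v"
      using L unfolding holo_on_def by blast
    then show "hol_at (\<lambda>z. f z $ j) z"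
      unfolding hol_at_def by (intro exI[of _ "\<lambda>v. L v $ j"]) (auto intro: has_derivative_nth)
  qed
next
  assume R: "\<forall>z\<in>S. \<forall>j. hol_at (\<lambda>z. f z $ j) z"
  show "holo_on f S" unfolding holo_on_def
  proof
    fix z assume "z \<in> S"
    then have "\<forall>j. \<exists>L. ((\<lambda>z. f z $ j) has_derivative L) (at z) \<and> (\<forall>v. L (\<i> *s v) = \<i> * L v)"
      using R by (simp add: hol_at_def)
    then obtain L where L: "\<And>j. ((\<lambda>z. f z $ j) has_derivative L j) (at z)"
      "\<And>j v. L j (\<i> *s v) = \<i> * L j v" by metis
    have "(f has_derivative (\<lambda>v. \<chi> j. L j v)) (at z)"
      by (subst has_derivative_componentwise_within)
        (auto simp: Basis_vec_def inner_axis intro!: has_derivative_inner_left L)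
    then show "\<exists>L. (f has_derivative L) (at z) \<and> (\<forall>v. L (\<i> *s v) = \<i> *s L v)"
      by (intro exI[of _ "\<lambda>v. \<chi> j. L j v"]) (auto simp: L vec_eq_iff)
  qed
qed

lemma holo_on_compose:
  assumes "holo_on f S" "f ` S \<subseteq> T" "holo_on g T"
  shows "holo_on (\<lambda>z. g (f z)) S"
  unfolding holo_on_def
proof
  fix z assume "z \<in> S"
  obtain L M where "(f has_derivative L) (at z)" "\<And>v. L (\<i> *s v) = \<i> *s L v"
    "(g has_derivative M) (at (f z))" "\<And>v. M (\<i> *s v) = \<i> *s M v"
    using assms \<open>z \<in> S\<close> unfolding holo_on_def by blast
  then show "\<exists>L. ((\<lambda>z. g (f z)) has_derivative L) (at z) \<and> (\<forall>v. L (\<i> *s v) = \<i> *s L v)"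
    by (intro exI[of _ "\<lambda>v. M (L v)"]) (auto intro: has_derivative_compose)
qed

lemma holo_on_transform:
  assumes "holo_on f S" "open S" "\<And>z. z \<in> S \<Longrightarrow> f z = g z"
  shows "holo_on g S"
  unfolding holo_on_def
proof
  fix z assume z: "z \<in> S"
  obtain L where "(f has_derivative L) (at z)" "\<And>v. L (\<i> *s v) = \<i> *s L v"
    using assms(1) z unfolding holo_on_def by blast
  then show "\<exists>L. (g has_derivative L) (at z) \<and> (\<forall>v. L (\<i> *s v) = \<i> *s L v)"
    using has_derivative_transform_within_open[of f L z UNIV S g] assms(2,3) z by auto
qed

lemma clinear_imaginary:
  fixes L :: "complex ^ 'm::finite \<Rightarrow> complex ^ 'k::finite"
  assumes "linear L" "\<And>v. L (\<i> *s v) = \<i> *s L v"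
  shows "L (c *s v) = c *s L v"
proof -
  have "c *s v = Re c *\<^sub>R v + Im c *\<^sub>R (\<i> *s v)"
    by (auto simp: vec_eq_iff complex_eq_iff)
  then have "L (c *s v) = Re c *\<^sub>R L v + Im c *\<^sub>R (\<i> *s L v)"
    using assms by (simp add: linear_add linear_scale)
  also have "\<dots> = c *s L v" by (auto simp: vec_eq_iff complex_eq_iff)
  finally show ?thesis .
qed

text \<open>Restriction to complex lines brings in one-variable theory: the first part feeds
  analytic continuation, and both parts feed the Schwarz lemma.\<close>

lemma holo_on_line:
  assumes f: "holo_on f S"
  shows "(\<lambda>\<zeta>. f (a + \<zeta> *s b) $ j) holomorphic_on {\<zeta>. a + \<zeta> *s b \<in> S}"
    and "0 \<in> S \<Longrightarrow> (f has_derivative L) (at 0) \<Longrightarrow>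
      ((\<lambda>\<zeta>. f (\<zeta> *s b) $ j) has_field_derivative L b $ j) (at 0)"
proof -
  have bl: "bounded_linear (\<lambda>\<zeta>. \<zeta> *s b)"
    by (intro linear_conv_bounded_linear[THEN iffD1] linearI) (auto simp: vec_eq_iff algebra_simps)
  have *: "((\<lambda>\<zeta>. f (a + \<zeta> *s b) $ j) has_field_derivative M b $ j) (at \<zeta>)"
    if fM: "(f has_derivative M) (at (a + \<zeta> *s b))" and S: "a + \<zeta> *s b \<in> S" for a \<zeta> M
  proof -
    obtain M' where M': "(f has_derivative M') (at (a + \<zeta> *s b))" "\<And>v. M' (\<i> *s v) = \<i> *s M' v"
      using f S unfolding holo_on_def by blast
    then have "M' = M" using fM has_derivative_unique by blast
    then have M: "M (c *s v) = c *s M v" for c v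
      using clinear_imaginary M' has_derivative_linear by blast
    have "((\<lambda>\<zeta>. a + \<zeta> *s b) has_derivative (\<lambda>\<zeta>. \<zeta> *s b)) (at \<zeta>)"
      using has_derivative_add[OF has_derivative_const bounded_linear_imp_has_derivative[OF bl]] by simp
    from has_derivative_nth[OF has_derivative_compose[OF this fM], of j]
    show ?thesis
      unfolding has_field_derivative_def by (simp add: M mult.commute[of _ "M b $ j"])
  qed
  show "(\<lambda>\<zeta>. f (a + \<zeta> *s b) $ j) holomorphic_on {\<zeta>. a + \<zeta> *s b \<in> S}"
    unfolding holomorphic_on_def
  proof
    fix \<zeta> assume "\<zeta> \<in> {\<zeta>. a + \<zeta> *s b \<in> S}"
    then have S: "a + \<zeta> *s b \<in> S" by simp
    then obtain M where "(f has_derivative M) (at (a + \<zeta> *s b))"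
      using f unfolding holo_on_def by blast
    from *[OF this S]
    show "(\<lambda>\<zeta>. f (a + \<zeta> *s b) $ j) field_differentiable at \<zeta> within {\<zeta>. a + \<zeta> *s b \<in> S}"
      using field_differentiable_at_within field_differentiable_def by blast
  qed
  show "((\<lambda>\<zeta>. f (\<zeta> *s b) $ j) has_field_derivative L b $ j) (at 0)"
    if "0 \<in> S" and "(f has_derivative L) (at 0)"
    using *[of L 0 0] that by simp
qed

text \<open>An automorphism with its inverse as explicit data: inversion becomes a swap of
  arguments, and \<open>the_inv_into\<close> occurs only in the passage to and from
  \<open>aut\<close>.\<close>

definition biholo :: "(complex ^ 'm::finite) set \<Rightarrow> (complex ^ 'm \<Rightarrow> complex ^ 'm) \<Rightarrow>
    (complex ^ 'm \<Rightarrow> complex ^ 'm) \<Rightarrow> bool" where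
  "biholo S f g \<longleftrightarrow> holo_on f S \<and> holo_on g S \<and>
     (\<forall>z\<in>S. f z \<in> S \<and> g z \<in> S \<and> g (f z) = z \<and> f (g z) = z)"

lemma biholo_sym: "biholo S f g \<Longrightarrow> biholo S g f"
  unfolding biholo_def by blast

lemma biholo_compose:
  assumes "biholo S f g" "biholo S f' g'"
  shows "biholo S (\<lambda>z. f' (f z)) (\<lambda>z. g (g' z))"
  using assms holo_on_compose[of f S S f'] holo_on_compose[of g' S S g] unfolding biholo_def by auto

lemma biholo_imp_aut:
  assumes "biholo S f g" "open S"
  shows "f \<in> aut S"
proof -
  have b: "bij_betw f S S"
    using assms(1) unfolding biholo_def by (intro bij_betw_byWitness[of _ g]) auto
  then have "g z = the_inv_into S f z" if "z \<in> S" for z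
    using assms(1) that unfolding biholo_def
    by (metis bij_betw_imp_inj_on the_inv_into_f_f)
  then show ?thesis
    using assms b holo_on_transform[OF _ assms(2), of g "the_inv_into S f"]
    unfolding aut_def biholo_def by auto
qed

lemma aut_imp_biholo:
  assumes "f \<in> aut S"
  shows "biholo S f (the_inv_into S f)"
proof -
  have "inj_on f S" and "f ` S = S"
    using assms unfolding aut_def bij_betw_def by auto
  then show ?thesis
    using assms the_inv_into_f_f[of f S] f_the_inv_into_f[of f S] the_inv_into_into[of f S _ S]
    unfolding aut_def biholo_def by blast
qed

section \<open>The Lie ball\<close>

definition bil :: "complex ^ 'm::finite \<Rightarrow> complex ^ 'm \<Rightarrow> complex" where
  "bil z w = (\<Sum>j\<in>UNIV. z $ j * w $ j)"

abbreviation qf :: "complex ^ 'm::finite \<Rightarrow> complex" where "qf z \<equiv> bil z z"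

definition real_vec :: "complex ^ 'm::finite \<Rightarrow> bool" where
  "real_vec u \<longleftrightarrow> (\<forall>j. Im (u $ j) = 0)"

definition tl_vec :: "complex ^ ('n::finite option) \<Rightarrow> complex ^ 'n" where
  "tl_vec w = (\<chi> j. w $ Some j)"

definition cons_vec :: "complex \<Rightarrow> complex ^ 'n::finite \<Rightarrow> complex ^ ('n option)" where
  "cons_vec a z = (\<chi> i. case i of None \<Rightarrow> a | Some j \<Rightarrow> z $ j)"

lemma cons_vec_nth [simp]: "cons_vec a z $ None = a" "cons_vec a z $ Some j = z $ j"
  and tl_cons_vec [simp]: "tl_vec (cons_vec a z) = z"
  and tl_vec_nth [simp]: "tl_vec w $ j = w $ Some j"
  by (auto simp: cons_vec_def tl_vec_def)

lemma vec_eq_iff_option: "(v :: 'a ^ 'n::finite option) = w \<longleftrightarrow> v $ None = w $ None \<and> (\<forall>j. v $ Some j = w $ Some j)"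
  by (metis option.exhaust vec_eq_iff)

lemma cons_vec_tl [simp]: "cons_vec (w $ None) (tl_vec w) = w"
  by (simp add: vec_eq_iff_option)

lemma embed0_eq: "embed0 z = cons_vec 0 z"
  by (simp add: embed0_def cons_vec_def)

lemma Lambda_map_eq: "Lambda_map z = cons_vec ((z $ None)\<^sup>2) (tl_vec z)"
  by (simp add: Lambda_map_def vec_eq_iff_option)

lemma sum_UNIV_option:
  fixes f :: "'n::finite option \<Rightarrow> 'a::comm_monoid_add"
  shows "(\<Sum>i\<in>UNIV. f i) = f None + (\<Sum>j\<in>UNIV. f (Some j))"
  by (simp add: UNIV_option_conv sum.reindex)

lemma bil_commute: "bil z w = bil w z"
  by (simp add: bil_def mult.commute)

lemma bil_add: "bil u (v + w) = bil u v + bil u w"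
  and bil_scale: "bil u (c *s v) = c * bil u v"
  by (simp_all add: bil_def sum.distrib distrib_left sum_distrib_left mult_ac)

lemma bil_add_left: "bil (v + w) u = bil v u + bil w u"
  and bil_scale_left: "bil (c *s v) u = c * bil v u"
  using bil_add bil_scale bil_commute by metis+

lemmas bil_simps = bil_add bil_scale bil_add_left bil_scale_left

lemma sqnorm_cnj: "complex_of_real (sqnorm z) = (\<Sum>j\<in>UNIV. z $ j * cnj (z $ j))"
  by (simp add: sqnorm_def complex_mult_cnj cmod_power2)

lemma sqnorm_eq_norm: "sqnorm z = (norm z)\<^sup>2"
  by (simp add: sqnorm_def norm_vec_def L2_set_def sum_nonneg)

lemma sqnorm_scale: "sqnorm (c *s z) = (cmod c)\<^sup>2 * sqnorm z"
  by (simp add: sqnorm_def norm_mult power_mult_distrib sum_distrib_left)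

lemma sqnorm_cons: "sqnorm (cons_vec a z) = (cmod a)\<^sup>2 + sqnorm z"
  by (simp add: sqnorm_def sum_UNIV_option)

lemma qf_cons: "qf (cons_vec a z) = a\<^sup>2 + qf z"
  by (simp add: bil_def sum_UNIV_option power2_eq_square)

lemma bil_cons: "bil (cons_vec a z) (cons_vec b w) = a * b + bil z w"
  by (simp add: bil_def sum_UNIV_option)

lemma cmod_qf_le: "cmod (qf z) \<le> sqnorm z"
  unfolding bil_def sqnorm_def by (rule sum_norm_le) (simp add: norm_mult power2_eq_square)

text \<open>The Lie ball inequality with the square root squared away. Since \<open>S\<close> and
  \<open>Q\<close> are free, the same condition describes \<open>LL\<close>, where they are |z|^2
  and z.z of a preimage z under \<open>Lambda_map\<close>, expressed through its image.\<close>

definition lie_cond :: "real \<Rightarrow> complex \<Rightarrow> bool" where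
  "lie_cond S Q \<longleftrightarrow> S < 1 \<and> 0 < 1 - 2 * S + (cmod Q)\<^sup>2"

lemma lie_ball_iff: "z \<in> lie_ball \<longleftrightarrow> lie_cond (sqnorm z) (qf z)"
proof -
  have eq: "(\<Sum>j\<in>UNIV. (z $ j)\<^sup>2) = qf z" by (simp add: bil_def power2_eq_square)
  have "sqrt ((sqnorm z)\<^sup>2 - (cmod (qf z))\<^sup>2) < 1 - sqnorm z \<longleftrightarrow>
      (sqnorm z)\<^sup>2 - (cmod (qf z))\<^sup>2 < (1 - sqnorm z)\<^sup>2" if "sqnorm z < 1"
    using that real_sqrt_less_iff[of "(sqnorm z)\<^sup>2 - (cmod (qf z))\<^sup>2" "(1 - sqnorm z)\<^sup>2"] by simp
  then show ?thesis
    unfolding lie_ball_def lie_cond_def mem_Collect_eq eq power2_diff by auto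
qed

text \<open>Squaring z_1 loses only its sign, which neither |z_1|^2 = |w_1| nor z_1^2 = w_1 sees.
  Hence any square root, here \<open>csqrt\<close>, gives a preimage.\<close>

lemma LL_iff: "w \<in> LL \<longleftrightarrow> lie_cond (cmod (w $ None) + sqnorm (tl_vec w)) (w $ None + qf (tl_vec w))"
proof
  assume "w \<in> LL"
  then obtain z where "z \<in> lie_ball" "w = Lambda_map z" by (auto simp: LL_def)
  then show "lie_cond (cmod (w $ None) + sqnorm (tl_vec w)) (w $ None + qf (tl_vec w))"
    using sqnorm_cons[of "z $ None" "tl_vec z"] qf_cons[of "z $ None" "tl_vec z"]
    by (simp add: lie_ball_iff Lambda_map_eq norm_power)
next
  assume R: "lie_cond (cmod (w $ None) + sqnorm (tl_vec w)) (w $ None + qf (tl_vec w))"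
  define z where "z = cons_vec (csqrt (w $ None)) (tl_vec w)"
  have "(cmod (csqrt (w $ None)))\<^sup>2 = cmod (w $ None)"
    by (metis norm_power power2_csqrt)
  then have "z \<in> lie_ball"
    using R by (simp add: lie_ball_iff z_def sqnorm_cons qf_cons)
  moreover have "w = Lambda_map z" by (simp add: Lambda_map_eq z_def)
  ultimately show "w \<in> LL" unfolding LL_def by blast
qed

lemma embed0_LL_iff: "embed0 z \<in> LL \<longleftrightarrow> z \<in> lie_ball"
  by (simp add: LL_iff lie_ball_iff embed0_eq)

lemma continuous_on_sqnorm [continuous_intros]:
  "continuous_on S f \<Longrightarrow> continuous_on S (\<lambda>x. sqnorm (f x))"
  unfolding sqnorm_def by (intro continuous_intros)

lemma continuous_on_bil [continuous_intros]:
  "continuous_on S f \<Longrightarrow> continuous_on S g \<Longrightarrow> continuous_on S (\<lambda>x. bil (f x) (g x))"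
  unfolding bil_def by (intro continuous_intros)

lemma continuous_on_tl_vec [continuous_intros]: "continuous_on S tl_vec"
  unfolding tl_vec_def[abs_def] by (intro continuous_intros)

lemma open_lie_cond:
  assumes "continuous_on UNIV f" "continuous_on UNIV g"
  shows "open {x. lie_cond (f x) (g x)}"
  unfolding lie_cond_def Collect_conj_eq
  by (intro open_Int open_Collect_less continuous_intros assms)

lemma open_lie_ball: "open (lie_ball :: (complex ^ 'm::finite) set)"
proof -
  have "lie_ball = {z :: complex ^ 'm. lie_cond (sqnorm z) (qf z)}"
    using lie_ball_iff by auto
  then show ?thesis
    by (rule ssubst) (intro open_lie_cond continuous_intros)
qed

lemma open_LL: "open (LL :: (complex ^ ('n::finite option)) set)"
proof -
  have "LL = {w :: complex ^ ('n option). lie_cond (cmod (w $ None) + sqnorm (tl_vec w)) (w $ None + qf (tl_vec w))}"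
    using LL_iff by auto
  then show ?thesis
    by (rule ssubst) (intro open_lie_cond continuous_intros)
qed

section \<open>Boosts along real directions\<close>

lemma real_vec_qf: "real_vec u \<Longrightarrow> qf u = complex_of_real (sqnorm u)"
  unfolding sqnorm_cnj bil_def real_vec_def by (intro sum.cong) (auto simp: complex_eq_iff)

lemma sqnorm_add_real:
  assumes "real_vec u"
  shows "sqnorm (z + a *s u) = sqnorm z + 2 * Re (cnj a * bil u z) + (cmod a)\<^sup>2 * sqnorm u"
proof -
  have u: "Im (u $ j) = 0" for j using assms by (simp add: real_vec_def)
  have "(cmod (z $ j + a * u $ j))\<^sup>2 = (cmod (z $ j))\<^sup>2 + 2 * Re (cnj a * (u $ j * z $ j)) + (cmod a)\<^sup>2 * (cmod (u $ j))\<^sup>2" for j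
    unfolding cmod_power2 by (simp add: u power2_eq_square algebra_simps)
  then have "sqnorm (z + a *s u) = (\<Sum>j\<in>UNIV. (cmod (z $ j))\<^sup>2) +
      (\<Sum>j\<in>UNIV. 2 * Re (cnj a * (u $ j * z $ j))) + (\<Sum>j\<in>UNIV. (cmod a)\<^sup>2 * (cmod (u $ j))\<^sup>2)"
    by (simp add: sqnorm_def sum.distrib)
  also have "(\<Sum>j\<in>UNIV. 2 * Re (cnj a * (u $ j * z $ j))) = 2 * Re (cnj a * bil u z)"
    unfolding bil_def by (simp only: sum_distrib_left Re_sum)
  finally show ?thesis
    by (simp add: sqnorm_def sum_distrib_left)
qed

text \<open>
  Keeps the denominator of a boost away from zero. The left-hand side is \<open>2 |u \<bullet> Re (z - Q cnj z)|\<close>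
  with \<open>Q = z\<bullet>z\<close>, to which the Cauchy-Schwarz inequality applies.
\<close>

lemma boost_bound:
  assumes z: "z \<in> lie_ball" and u: "real_vec u" "sqnorm u = 1"
  shows "2 * \<bar>Re (bil u z * (1 - cnj (qf z)))\<bar> \<le> 1 - (cmod (qf z))\<^sup>2"
proof -
  define A where "A = (\<Sum>j\<in>UNIV. (Re (z $ j))\<^sup>2)"
  define B where "B = (\<Sum>j\<in>UNIV. (Im (z $ j))\<^sup>2)"
  define C where "C = (\<Sum>j\<in>UNIV. Re (z $ j) * Im (z $ j))"
  have q: "Re (qf z) = A - B" "Im (qf z) = 2 * C"
    by (simp_all add: bil_def A_def B_def C_def power2_eq_square sum_subtractf sum.distrib sum_distrib_left mult_ac)
  have N: "sqnorm z = A + B"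
    by (simp add: sqnorm_def A_def B_def cmod_power2 sum.distrib)
  have m: "(cmod (qf z))\<^sup>2 = (A - B)\<^sup>2 + 4 * C\<^sup>2"
    by (simp add: cmod_power2 q power_mult_distrib)
  have u0: "Im (u $ j) = 0" for j using u(1) by (simp add: real_vec_def)
  have u1: "(\<Sum>j\<in>UNIV. (Re (u $ j))\<^sup>2) = 1"
    using u(2) by (simp add: sqnorm_def cmod_power2 u0)
  define w where "w j = (1 - (A - B)) * Re (z $ j) - 2 * C * Im (z $ j)" for j
  have "Re (bil u z * (1 - cnj (qf z))) = (\<Sum>j\<in>UNIV. Re (u $ j) * w j)"
    by (simp add: bil_def[of u] q u0 w_def sum_distrib_left sum_distrib_right sum_subtractf[symmetric] sum.distrib[symmetric] algebra_simps)
  moreover have "(\<Sum>j\<in>UNIV. Re (u $ j) * w j)\<^sup>2 \<le> (\<Sum>j\<in>UNIV. (Re (u $ j))\<^sup>2) * (\<Sum>j\<in>UNIV. (w j)\<^sup>2)"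
    by (rule Cauchy_Schwarz_ineq_sum)
  ultimately have 1: "(Re (bil u z * (1 - cnj (qf z))))\<^sup>2 \<le> (\<Sum>j\<in>UNIV. (w j)\<^sup>2)"
    by (simp add: u1)
  have wj: "(w j)\<^sup>2 = (1 - (A - B))\<^sup>2 * (Re (z $ j))\<^sup>2 - 4 * C * (1 - (A - B)) * (Re (z $ j) * Im (z $ j))
      + 4 * C\<^sup>2 * (Im (z $ j))\<^sup>2" for j
    unfolding w_def by algebra
  have "(\<Sum>j\<in>UNIV. (w j)\<^sup>2) = (1 - (A - B))\<^sup>2 * A - 4 * C * (1 - (A - B)) * C + 4 * C\<^sup>2 * B"
    unfolding wj sum.distrib sum_subtractf A_def B_def C_def sum_distrib_left by simp
  \<comment> \<open>With Q = z.z this reads 4 |w|^2 = (1 - |Q|^2)^2 - (1 - 2 |z|^2 + |Q|^2) |1 -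
    Q|^2, and membership in the Lie ball makes the subtracted product nonnegative.\<close>
  then have 2: "4 * (\<Sum>j\<in>UNIV. (w j)\<^sup>2) = (1 - ((A - B)\<^sup>2 + 4 * C\<^sup>2))\<^sup>2
      - (1 - 2 * (A + B) + ((A - B)\<^sup>2 + 4 * C\<^sup>2)) * ((1 - (A - B))\<^sup>2 + 4 * C\<^sup>2)"
    by algebra
  have pos: "0 < 1 - 2 * sqnorm z + (cmod (qf z))\<^sup>2" and S: "sqnorm z < 1"
    using z by (auto simp: lie_ball_iff lie_cond_def)
  have "0 \<le> (1 - 2 * (A + B) + ((A - B)\<^sup>2 + 4 * C\<^sup>2)) * ((1 - (A - B))\<^sup>2 + 4 * C\<^sup>2)"
    using pos unfolding N m by (intro mult_nonneg_nonneg) auto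
  then have "(2 * Re (bil u z * (1 - cnj (qf z))))\<^sup>2 \<le> (1 - (cmod (qf z))\<^sup>2)\<^sup>2"
    using 1 2 unfolding m power_mult_distrib by simp
  moreover have "0 \<le> 1 - (cmod (qf z))\<^sup>2"
    using S cmod_qf_le[of z] power_le_one[of "cmod (qf z)" 2] by simp
  ultimately have "\<bar>2 * Re (bil u z * (1 - cnj (qf z)))\<bar> \<le> 1 - (cmod (qf z))\<^sup>2"
    by (metis abs_le_square_iff abs_of_nonneg)
  then show ?thesis by (simp only: abs_mult abs_numeral)
qed

text \<open>
  In the homogeneous coordinates \<open>(1, z, Q)\<close> with \<open>Q = z\<bullet>z\<close>, whose entries satisfy
  \<open>((1 + Q)/2)\<^sup>2 - ((1 - Q)/2)\<^sup>2 = z\<bullet>z\<close>, the boost along a real unit vector \<open>u\<close> applies the hyperbolic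
  rotation \<open>(c, s)\<close> to the pair \<open>((1 + Q)/2, u\<bullet>z)\<close>. With \<open>t = u\<bullet>z\<close>, the result has first and last
  coordinate \<open>boost_den\<close> and \<open>boost_num\<close>, and \<open>z\<close> is moved by \<open>boost_shift\<close> in the direction \<open>u\<close>.
  On the lifted domain \<open>Q\<close> becomes \<open>w\<^sub>1 + w'\<bullet>w'\<close>.
\<close>

definition boost_den :: "real \<Rightarrow> real \<Rightarrow> complex \<Rightarrow> complex \<Rightarrow> complex" where
  "boost_den c s t Q = (c + 1) / 2 + s * t + (c - 1) / 2 * Q"

definition boost_num :: "real \<Rightarrow> real \<Rightarrow> complex \<Rightarrow> complex \<Rightarrow> complex" where
  "boost_num c s t Q = (c - 1) / 2 + s * t + (c + 1) / 2 * Q"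

definition boost_shift :: "real \<Rightarrow> real \<Rightarrow> complex \<Rightarrow> complex \<Rightarrow> complex" where
  "boost_shift c s t Q = (c - 1) * t + s * (1 + Q) / 2"

definition boost_vec :: "complex ^ 'm::finite \<Rightarrow> real \<Rightarrow> real \<Rightarrow> complex \<Rightarrow> complex ^ 'm \<Rightarrow> complex ^ 'm" where
  "boost_vec u c s Q z =
     (1 / boost_den c s (bil u z) Q) *s (z + boost_shift c s (bil u z) Q *s u)"

definition boost :: "complex ^ 'm::finite \<Rightarrow> real \<Rightarrow> real \<Rightarrow> complex ^ 'm \<Rightarrow> complex ^ 'm" where
  "boost u c s z = boost_vec u c s (qf z) z"

definition boost_lift :: "complex ^ 'n::finite \<Rightarrow> real \<Rightarrow> real \<Rightarrow> complex ^ ('n option) \<Rightarrow> complex ^ ('n option)" where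
  "boost_lift u c s w = (let Q = w $ None + qf (tl_vec w) in
     cons_vec (w $ None / (boost_den c s (bil u (tl_vec w)) Q)\<^sup>2) (boost_vec u c s Q (tl_vec w)))"

lemmas boost_defs = boost_den_def boost_num_def boost_shift_def

text \<open>The pair ((den + num)/2, t + shift) is the hyperbolic rotation of ((1 + Q)/2, t), while
  den - num = 1 - Q is unchanged. The relation ((1 + Q)/2)^2 - ((1 - Q)/2)^2 = z.z therefore
  persists.\<close>

lemma boost_qf:
  assumes "c\<^sup>2 = 1 + s\<^sup>2"
  shows "Q + 2 * boost_shift c s t Q * t + (boost_shift c s t Q)\<^sup>2 = boost_den c s t Q * boost_num c s t Q"
proof -
  define C S where CS: "C = complex_of_real c" "S = complex_of_real s"
  have C: "C\<^sup>2 = 1 + S\<^sup>2" unfolding CS using assms(1)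
    by (metis of_real_1 of_real_add of_real_power)
  define D where "D = boost_den c s t Q"
  define E where "E = boost_num c s t Q"
  define a where "a = boost_shift c s t Q"
  \<comment> \<open>Doubling clears the denominators of the definitions, so that
    \<open>algebra\<close> sees polynomial relations only.\<close>
  have D: "2 * D = (C + 1) + 2 * S * t + (C - 1) * Q"
    and E: "2 * E = (C - 1) + 2 * S * t + (C + 1) * Q"
    and a: "2 * a = 2 * (C - 1) * t + S * (1 + Q)"
    unfolding D_def E_def a_def boost_defs CS by (simp_all add: field_simps)
  have "4 * (Q + 2 * a * t + a\<^sup>2) = 4 * (D * E)"
    using C D E a by algebra
  then show ?thesis
    unfolding D_def E_def a_def by (rule mult_left_cancel[THEN iffD1, rotated]) simp
qed

text \<open>|den|^2 - |num|^2 is the real part of (den - num) cnj (den + num), and den - num = 1 -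
  Q. Up to the factor s, the last term is the quantity estimated in
  \<open>boost_bound\<close>.\<close>

lemma boost_den_num:
  "(cmod (boost_den c s t Q))\<^sup>2 - (cmod (boost_num c s t Q))\<^sup>2 =
     c * (1 - (cmod Q)\<^sup>2) + 2 * s * Re (t * (1 - cnj Q))"
  unfolding cmod_power2 boost_defs by (simp add: power2_eq_square field_simps)

text \<open>Invariance of the Hermitian form of signature (2,n) behind the second Lie ball
  inequality. The bracket is |z + shift u|^2 when N = |z|^2, t = u.z and u is a real unit
  vector.\<close>

lemma boost_hermitian:
  assumes "c\<^sup>2 = 1 + s\<^sup>2"
  shows "(cmod (boost_den c s t Q))\<^sup>2 + (cmod (boost_num c s t Q))\<^sup>2
      - 2 * (N + 2 * Re (cnj (boost_shift c s t Q) * t) + (cmod (boost_shift c s t Q))\<^sup>2) =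
    1 + (cmod Q)\<^sup>2 - 2 * N"
proof -
  define t1 t2 q1 q2 where d: "t1 = Re t" "t2 = Im t" "q1 = Re Q" "q2 = Im Q"
  have "2 * ((cmod (boost_den c s t Q))\<^sup>2 + (cmod (boost_num c s t Q))\<^sup>2
      - 2 * (N + 2 * Re (cnj (boost_shift c s t Q) * t) + (cmod (boost_shift c s t Q))\<^sup>2)) =
    (c + 2 * s * t1 + c * q1)\<^sup>2 + (1 - q1)\<^sup>2 + (2 * s * t2 + c * q2)\<^sup>2 + q2\<^sup>2
     - 4 * N - 4 * (2 * (c - 1) * t1 + s * (1 + q1)) * t1 - 4 * (2 * (c - 1) * t2 + s * q2) * t2
     - (2 * (c - 1) * t1 + s * (1 + q1))\<^sup>2 - (2 * (c - 1) * t2 + s * q2)\<^sup>2"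
    unfolding cmod_power2 boost_defs by (simp add: d[symmetric] power2_eq_square field_simps)
  also have "\<dots> = 2 * (1 + (q1\<^sup>2 + q2\<^sup>2) - 2 * N)"
    using assms by algebra
  finally show ?thesis by (simp add: cmod_power2 d)
qed

text \<open>\<open>boost_den\<close> and \<open>boost_shift\<close> are linear in the homogeneous
  coordinates (1, t, Q), and the rotation with \<open>- s\<close> returns (den, t + shift, num) to
  (1, t, Q). Normalising by den produces the factors 1 / den.\<close>

lemma boost_den_inverse:
  assumes "c\<^sup>2 = 1 + s\<^sup>2" "boost_den c s t Q \<noteq> 0"
  defines "t' \<equiv> (t + boost_shift c s t Q) / boost_den c s t Q"
    and "Q' \<equiv> boost_num c s t Q / boost_den c s t Q"
  shows "boost_den c (- s) t' Q' = 1 / boost_den c s t Q"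
    and "boost_shift c (- s) t' Q' = - boost_shift c s t Q / boost_den c s t Q"
proof -
  define C S where CS: "C = complex_of_real c" "S = complex_of_real s"
  have C: "C\<^sup>2 = 1 + S\<^sup>2" unfolding CS using assms(1)
    by (metis of_real_1 of_real_add of_real_power)
  define D where "D = boost_den c s t Q"
  define E where "E = boost_num c s t Q"
  define a where "a = boost_shift c s t Q"
  have D: "2 * D = (C + 1) + 2 * S * t + (C - 1) * Q"
    and E: "2 * E = (C - 1) + 2 * S * t + (C + 1) * Q"
    and a: "2 * a = 2 * (C - 1) * t + S * (1 + Q)"
    unfolding D_def E_def a_def boost_defs CS by (simp_all add: field_simps)
  have "D \<noteq> 0" using assms(2) by (simp add: D_def)
  have "4 * ((C + 1) * D - 2 * S * (t + a) + (C - 1) * E) = 4 * 2"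
    using C D E a by algebra
  then have 1: "(C + 1) * D - 2 * S * (t + a) + (C - 1) * E = 2"
    by (rule mult_left_cancel[THEN iffD1, rotated]) simp
  have "4 * (2 * (C - 1) * (t + a) - S * (D + E)) = 4 * (- 2 * a)"
    using C D E a by algebra
  then have 2: "2 * (C - 1) * (t + a) - S * (D + E) = - 2 * a"
    by (rule mult_left_cancel[THEN iffD1, rotated]) simp
  have "2 * D * boost_den c (- s) t' Q' = (C + 1) * D - 2 * S * (t + a) + (C - 1) * E"
    unfolding t'_def Q'_def boost_den_def[of c "- s"] D_def[symmetric] E_def[symmetric] a_def[symmetric]
    using \<open>D \<noteq> 0\<close> by (simp add: CS field_simps)
  then show "boost_den c (- s) t' Q' = 1 / boost_den c s t Q"
    using \<open>D \<noteq> 0\<close> unfolding 1 D_def[symmetric] by (simp add: field_simps)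
  have "2 * D * boost_shift c (- s) t' Q' = 2 * (C - 1) * (t + a) - S * (D + E)"
    unfolding t'_def Q'_def boost_shift_def[of c "- s"] D_def[symmetric] E_def[symmetric] a_def[symmetric]
    using \<open>D \<noteq> 0\<close> by (simp add: CS field_simps)
  then show "boost_shift c (- s) t' Q' = - boost_shift c s t Q / boost_den c s t Q"
    using \<open>D \<noteq> 0\<close> unfolding 2 D_def[symmetric] a_def[symmetric] by (simp add: field_simps)
qed

lemma hol_at_bil: "hol_at (\<lambda>z. bil v z) z" and hol_at_qf: "hol_at (\<lambda>z. qf z) z"
  unfolding bil_def by (intro hol_at_intros hol_at_nth hol_at_const)+

text \<open>The numbers c and s are cosh and sinh of a rapidity; c > 0 selects the branch on which
  |s| < c.\<close>

locale boost_data =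
  fixes u :: "complex ^ 'm::finite" and c s :: real
  assumes u: "real_vec u" "sqnorm u = 1" and cs: "c\<^sup>2 = 1 + s\<^sup>2" "c > 0"
begin

lemma neg: "boost_data u c (- s)"
  by unfold_locales (simp_all add: u cs)

lemma den_gt_num:
  assumes "z \<in> lie_ball"
  shows "cmod (boost_num c s (bil u z) (qf z)) < cmod (boost_den c s (bil u z) (qf z))"
proof -
  define r where "r = Re (bil u z * (1 - cnj (qf z)))"
  have r: "2 * \<bar>r\<bar> \<le> 1 - (cmod (qf z))\<^sup>2"
    using boost_bound[OF assms u] by (simp only: r_def)
  have S: "\<bar>s\<bar> < c" by (rule power2_less_imp_less) (use cs in simp_all)
  have "cmod (qf z) < 1" using cmod_qf_le[of z] assms by (auto simp: lie_ball_iff lie_cond_def)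
  then have m: "0 < 1 - (cmod (qf z))\<^sup>2" by (simp add: power_less_one_iff)
  have "\<bar>2 * s * r\<bar> \<le> \<bar>s\<bar> * (1 - (cmod (qf z))\<^sup>2)"
    using mult_left_mono[OF r, of "\<bar>s\<bar>"] by (simp add: abs_mult mult_ac)
  also have "\<dots> < c * (1 - (cmod (qf z))\<^sup>2)" using S m by simp
  finally have "0 < c * (1 - (cmod (qf z))\<^sup>2) + 2 * s * r" by linarith
  then have "(cmod (boost_num c s (bil u z) (qf z)))\<^sup>2 < (cmod (boost_den c s (bil u z) (qf z)))\<^sup>2"
    using boost_den_num[of c s "bil u z" "qf z"] unfolding r_def by linarith
  then show ?thesis by (rule power2_less_imp_less) simp
qed

lemma den_nonzero: "z \<in> lie_ball \<Longrightarrow> boost_den c s (bil u z) (qf z) \<noteq> 0"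
  using den_gt_num[of z] norm_not_less_zero norm_zero by metis

lemma qf_u: "qf u = 1"
  using real_vec_qf[OF u(1)] u(2) by simp

lemma boost_image:
  assumes z: "z \<in> lie_ball"
  defines "t \<equiv> bil u z" and "Q \<equiv> qf z"
  shows "bil u (boost u c s z) = (t + boost_shift c s t Q) / boost_den c s t Q"
    and "qf (boost u c s z) = boost_num c s t Q / boost_den c s t Q"
    and "boost u c s z \<in> lie_ball"
proof -
  define D where "D = boost_den c s t Q"
  define E where "E = boost_num c s t Q"
  define a where "a = boost_shift c s t Q"
  have D0: "D \<noteq> 0" and ED: "cmod E < cmod D"
    using den_nonzero[OF z] den_gt_num[OF z] by (simp_all add: D_def E_def t_def Q_def)
  have b: "boost u c s z = (1 / D) *s (z + a *s u)"
    by (simp add: boost_def boost_vec_def D_def a_def t_def Q_def)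
  show "bil u (boost u c s z) = (t + boost_shift c s t Q) / boost_den c s t Q"
    unfolding b by (simp add: bil_simps qf_u D_def[symmetric] a_def[symmetric] t_def[symmetric] add_divide_distrib)
  have "qf (z + a *s u) = Q + 2 * a * t + a\<^sup>2"
    by (simp add: bil_simps qf_u Q_def t_def bil_commute[of z u] power2_eq_square algebra_simps)
  also have "\<dots> = D * E" unfolding D_def E_def a_def by (rule boost_qf[OF cs(1)])
  finally have "qf (z + a *s u) = D * E" .
  moreover have "qf ((1 / D) *s v) = qf v / (D * D)" for v :: "complex ^ 'm"
    by (simp add: bil_scale bil_scale_left)
  ultimately have qf: "qf (boost u c s z) = E / D"
    unfolding b using D0 by (simp del: vector_add_ldistrib)
  then show "qf (boost u c s z) = boost_num c s t Q / boost_den c s t Q"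
    by (simp add: E_def D_def)
  define N where "N = sqnorm (z + a *s u)"
  have "N = sqnorm z + 2 * Re (cnj a * t) + (cmod a)\<^sup>2"
    unfolding N_def t_def using sqnorm_add_real[OF u(1)] u(2) by simp
  then have H: "(cmod D)\<^sup>2 + (cmod E)\<^sup>2 - 2 * N = 1 + (cmod Q)\<^sup>2 - 2 * sqnorm z"
    using boost_hermitian[OF cs(1), of t Q "sqnorm z"] by (simp add: D_def E_def a_def)
  then have H0: "2 * N < (cmod D)\<^sup>2 + (cmod E)\<^sup>2"
    using z by (simp add: lie_ball_iff lie_cond_def Q_def)
  have sq: "sqnorm (boost u c s z) = N / (cmod D)\<^sup>2"
    unfolding b N_def by (simp add: sqnorm_scale norm_divide power_divide del: vector_add_ldistrib)
  have E2: "(cmod E)\<^sup>2 < (cmod D)\<^sup>2" using ED by (simp add: power_strict_mono)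
  \<comment> \<open>The preserved Hermitian form alone would admit images with \<open>sqnorm\<close>
    above 1; |E| < |D| excludes them.\<close>
  have "N < (cmod D)\<^sup>2" using H0 E2 by linarith
  then show "boost u c s z \<in> lie_ball"
    unfolding lie_ball_iff lie_cond_def qf sq using H0 D0
    by (simp add: norm_divide power_divide field_simps)
qed

lemma boost_inverse:
  assumes z: "z \<in> lie_ball"
  shows "boost u c (- s) (boost u c s z) = z"
proof -
  define D where "D = boost_den c s (bil u z) (qf z)"
  define a where "a = boost_shift c s (bil u z) (qf z)"
  have D0: "D \<noteq> 0" using den_nonzero[OF z] by (simp add: D_def)
  have b: "boost u c s z = (1 / D) *s (z + a *s u)"
    by (simp add: boost_def boost_vec_def D_def a_def)
  have "boost u c (- s) (boost u c s z) = (1 / (1 / D)) *s (boost u c s z + (- a / D) *s u)"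
    unfolding boost_def[of u c "- s"] boost_vec_def
    unfolding boost_image(1,2)[OF z] boost_den_inverse[OF cs(1) den_nonzero[OF z]]
    unfolding D_def a_def ..
  then show ?thesis
    unfolding b using D0 by (simp add: vec_eq_iff field_simps)
qed

lemma holo_boost: "holo_on (boost u c s) lie_ball"
  unfolding holo_on_componentwise
proof (intro ballI allI)
  fix z :: "complex ^ 'm" and j assume z: "z \<in> lie_ball"
  show "hol_at (\<lambda>z. boost u c s z $ j) z"
    using den_nonzero[OF z] unfolding boost_def boost_vec_def boost_den_def boost_shift_def
      vector_smult_component vector_add_component
    by (intro hol_at_intros hol_at_nth hol_at_const hol_at_bil hol_at_qf) auto
qed

lemma biholo_boost: "biholo lie_ball (boost u c s) (boost u c (- s))"
  unfolding biholo_def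
proof (intro conjI ballI)
  fix z :: "complex ^ 'm" assume z: "z \<in> lie_ball"
  show "boost u c s z \<in> lie_ball" "boost u c (- s) z \<in> lie_ball"
    by (rule boost_image(3)[OF z], rule boost_data.boost_image(3)[OF neg z])
  show "boost u c (- s) (boost u c s z) = z" "boost u c s (boost u c (- s) z) = z"
    by (rule boost_inverse[OF z], use boost_data.boost_inverse[OF neg z] in simp)
qed (rule holo_boost boost_data.holo_boost[OF neg])+

end

section \<open>Automorphisms that lift\<close>

definition lifts :: "(complex ^ 'n::finite \<Rightarrow> complex ^ 'n) \<Rightarrow> (complex ^ 'n \<Rightarrow> complex ^ 'n) \<Rightarrow> bool" where
  "lifts f g \<longleftrightarrow> biholo lie_ball f g \<and>
     (\<exists>F G. biholo LL F G \<and> (\<forall>z\<in>lie_ball. F (embed0 z) = embed0 (f z)))"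

lemma lifts_biholo: "lifts f g \<Longrightarrow> biholo lie_ball f g"
  by (simp add: lifts_def)

lemma liftsI:
  "biholo lie_ball f g \<Longrightarrow> biholo LL F G \<Longrightarrow>
    (\<And>z. z \<in> lie_ball \<Longrightarrow> F (embed0 z) = embed0 (f z)) \<Longrightarrow> lifts f g"
  unfolding lifts_def by blast

lemma liftsE:
  assumes "lifts f g"
  obtains F G where "biholo LL F G" "\<And>z. z \<in> lie_ball \<Longrightarrow> F (embed0 z) = embed0 (f z)"
  using assms unfolding lifts_def by blast

lemma biholoD:
  assumes "biholo S f g" "z \<in> S"
  shows "f z \<in> S" "g z \<in> S" "g (f z) = z" "f (g z) = z"
  using assms by (simp_all add: biholo_def)

lemma lifts_sym:
  assumes "lifts f g"
  shows "lifts g f"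
proof -
  obtain F G where F: "biholo LL F G" "\<And>z. z \<in> lie_ball \<Longrightarrow> F (embed0 z) = embed0 (f z)"
    using liftsE[OF assms] by metis
  show ?thesis
  proof (rule liftsI)
    show "biholo lie_ball g f" by (rule biholo_sym[OF lifts_biholo[OF assms]])
    show "biholo LL G F" by (rule biholo_sym[OF F(1)])
    show "G (embed0 z) = embed0 (g z)" if z: "z \<in> lie_ball" for z
    proof -
      note g = biholoD(2,4)[OF lifts_biholo[OF assms] z]
      have "G (F (embed0 (g z))) = embed0 (g z)"
        using biholoD(3)[OF F(1)] g(1) by (simp add: embed0_LL_iff)
      then show ?thesis by (simp add: F(2) g)
    qed
  qed
qed

lemma lifts_compose:
  assumes "lifts f g" "lifts f' g'"
  shows "lifts (\<lambda>z. f' (f z)) (\<lambda>z. g (g' z))"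
proof -
  obtain F G where F: "biholo LL F G" "\<And>z. z \<in> lie_ball \<Longrightarrow> F (embed0 z) = embed0 (f z)"
    using liftsE[OF assms(1)] by metis
  obtain F' G' where F': "biholo LL F' G'" "\<And>z. z \<in> lie_ball \<Longrightarrow> F' (embed0 z) = embed0 (f' z)"
    using liftsE[OF assms(2)] by metis
  show ?thesis
    by (rule liftsI[OF biholo_compose[OF lifts_biholo lifts_biholo] biholo_compose[OF F(1) F'(1)], OF assms])
      (simp add: F(2) F'(2) biholoD(1)[OF lifts_biholo[OF assms(1)]])
qed

text \<open>A boost along (0, u) divides z_1 by the denominator, hence z_1^2 by its square, and the
  other coordinates depend on z_1 only through z_1^2. So \<open>boost_lift\<close> is the descent of
  a boost one dimension up.\<close>

lemma boost_lift_Lambda: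
  "boost_lift u c s (Lambda_map z) = Lambda_map (boost (cons_vec 0 u) c s z)"
proof -
  define a v where av: "a = z $ None" "v = tl_vec z"
  have z: "z = cons_vec a v" by (simp add: av)
  have "boost (cons_vec 0 u) c s z = cons_vec (a / boost_den c s (bil u v) (a\<^sup>2 + qf v)) (boost_vec u c s (a\<^sup>2 + qf v) v)"
    by (simp add: z boost_def boost_vec_def qf_cons bil_cons vec_eq_iff_option)
  moreover have "Lambda_map z = cons_vec (a\<^sup>2) v"
    by (simp add: z Lambda_map_eq)
  ultimately show ?thesis
    by (simp add: Lambda_map_eq boost_lift_def power_divide Let_def)
qed

lemma boost_lift_embed0: "boost_lift u c s (embed0 z) = embed0 (boost u c s z)"
  by (simp add: embed0_eq boost_lift_def boost_def)

lemma hol_at_bil_tl: "hol_at (\<lambda>w. bil u (tl_vec w)) w" and hol_at_qf_tl: "hol_at (\<lambda>w. qf (tl_vec w)) w"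
  unfolding bil_def tl_vec_nth by (intro hol_at_intros hol_at_nth hol_at_const)+

lemma holo_on_cons_vec:
  assumes "\<And>w. w \<in> S \<Longrightarrow> hol_at f w" "\<And>w j. w \<in> S \<Longrightarrow> hol_at (\<lambda>w. g w $ j) w"
  shows "holo_on (\<lambda>w. cons_vec (f w) (g w)) S"
  unfolding holo_on_componentwise
proof (intro ballI allI)
  fix w j assume "w \<in> S"
  then show "hol_at (\<lambda>w. cons_vec (f w) (g w) $ j) w"
    using assms by (cases j) auto
qed

text \<open>Invariance of \<open>LL\<close>, the inverse and the nonzero denominator are read off
  from the boost along (0, u) at a preimage under \<open>Lambda_map\<close>. Holomorphy is checked
  on the formula instead, as \<open>Lambda_map\<close> has no holomorphic inverse near z_1 =
  0.\<close>

lemma lifts_boost: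
  fixes u :: "complex ^ 'n::finite"
  assumes bu: "boost_data u c s"
  shows "lifts (boost u c s) (boost u c (- s))"
proof -
  interpret boost_data u c s by (rule bu)
  \<comment> \<open>The parameter t stands for s and - s at once.\<close>
  have bd: "boost_data (cons_vec 0 u) c t" if "t\<^sup>2 = s\<^sup>2" for t
  proof (rule boost_data.intro)
    show "real_vec (cons_vec 0 u)"
      using u(1) by (auto simp: real_vec_def cons_vec_def split: option.split)
  qed (simp_all add: sqnorm_cons u cs that)
  have into: "boost_lift u c t w \<in> LL" and inv: "boost_lift u c (- t) (boost_lift u c t w) = w"
    and den: "boost_den c t (bil u (tl_vec w)) (w $ None + qf (tl_vec w)) \<noteq> 0"
    if w: "w \<in> LL" and t: "t\<^sup>2 = s\<^sup>2" for w t
  proof -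
    obtain z where z: "z \<in> lie_ball" "w = Lambda_map z" using w by (auto simp: LL_def)
    interpret z: boost_data "cons_vec 0 u" c t by (rule bd[OF t])
    show "boost_lift u c t w \<in> LL"
      unfolding z(2) boost_lift_Lambda using z.boost_image(3)[OF z(1)] by (simp add: LL_def)
    show "boost_lift u c (- t) (boost_lift u c t w) = w"
      unfolding z(2) boost_lift_Lambda using z.boost_inverse[OF z(1)] by simp
    show "boost_den c t (bil u (tl_vec w)) (w $ None + qf (tl_vec w)) \<noteq> 0"
      using z.den_nonzero[OF z(1)] qf_cons[of "z $ None" "tl_vec z"] bil_cons[of 0 u "z $ None" "tl_vec z"]
      by (simp add: z(2) Lambda_map_eq)
  qed
  have holo: "holo_on (boost_lift u c t) LL" if "t\<^sup>2 = s\<^sup>2" for t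
    unfolding boost_lift_def[abs_def] Let_def
  proof (rule holo_on_cons_vec)
    fix w :: "complex ^ 'n option" and j assume w: "w \<in> LL"
    show "hol_at (\<lambda>w. w $ None / (boost_den c t (bil u (tl_vec w)) (w $ None + qf (tl_vec w)))\<^sup>2) w"
      using den[OF w that] unfolding boost_den_def
      by (intro hol_at_intros hol_at_nth hol_at_const hol_at_bil_tl hol_at_qf_tl) auto
    show "hol_at (\<lambda>w. boost_vec u c t (w $ None + qf (tl_vec w)) (tl_vec w) $ j) w"
      using den[OF w that] unfolding boost_vec_def boost_den_def boost_shift_def
        vector_smult_component vector_add_component tl_vec_nth
      by (intro hol_at_intros hol_at_nth hol_at_const hol_at_bil_tl hol_at_qf_tl) auto
  qed
  have "biholo LL (boost_lift u c s) (boost_lift u c (- s))"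
    unfolding biholo_def
  proof (intro conjI ballI holo)
    fix w :: "complex ^ 'n option" assume w: "w \<in> LL"
    show "boost_lift u c s w \<in> LL" "boost_lift u c (- s) w \<in> LL"
      by (rule into[OF w], simp)+
    show "boost_lift u c (- s) (boost_lift u c s w) = w" by (rule inv[OF w refl])
    show "boost_lift u c s (boost_lift u c (- s) w) = w" using inv[OF w, of "- s"] by simp
  qed simp_all
  then show ?thesis
    by (rule liftsI[OF biholo_boost]) (rule boost_lift_embed0)
qed

section \<open>Unitary linear maps and scalar rotations\<close>

definition clin :: "(complex ^ 'm::finite \<Rightarrow> complex ^ 'k::finite) \<Rightarrow> bool" where
  "clin A \<longleftrightarrow> linear A \<and> (\<forall>c v. A (c *s v) = c *s A v)"

lemma clin_expand:
  assumes "clin A"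
  shows "A v $ j = (\<Sum>k\<in>UNIV. v $ k * A (axis k 1) $ j)"
proof -
  have "A v = A (\<Sum>k\<in>UNIV. v $ k *s axis k 1)" by (simp only: basis_expansion)
  also have "\<dots> = (\<Sum>k\<in>UNIV. v $ k *s A (axis k 1))"
    using assms by (simp add: clin_def linear_sum)
  finally show ?thesis by simp
qed

lemma hol_at_clin:
  assumes "clin A" "\<And>k. hol_at (\<lambda>w. f w $ k) w"
  shows "hol_at (\<lambda>w. A (f w) $ j) w"
  unfolding clin_expand[OF assms(1), of "f _"] by (intro hol_at_intros hol_at_const assms(2))

text \<open>Under (w_1, w') -> (kappa w_1, A w') the expression w_1 + w'.w' is multiplied by kappa,
  so its modulus, and with it the condition of \<open>LL_iff\<close>, is preserved.\<close>

lemma lifts_linear: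
  fixes A B :: "complex ^ 'n::finite \<Rightarrow> complex ^ 'n"
  assumes A: "clin A" and B: "clin B" and AB: "\<And>z. A (B z) = z" and BA: "\<And>z. B (A z) = z"
    and N: "\<And>z. sqnorm (A z) = sqnorm z" and Q: "\<And>z. qf (A z) = \<kappa> * qf z" and k: "cmod \<kappa> = 1"
  shows "lifts A B"
proof -
  have kk: "\<kappa> * cnj \<kappa> = 1" using k by (metis complex_norm_square of_real_1 one_power2)
  then have k1: "\<kappa> * (cnj \<kappa> * x) = x" and k2: "cnj \<kappa> * (\<kappa> * x) = x" for x
    using kk by (simp_all add: mult.commute[of "cnj \<kappa>" \<kappa>] flip: mult.assoc)
  have NB: "sqnorm (B z) = sqnorm z" for z using N[of "B z"] AB by simp
  have QB: "qf (B z) = cnj \<kappa> * qf z" for z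
    using Q[of "B z"] by (simp add: AB k2)
  \<comment> \<open>One definition for the lift of A, with kappa, and for its inverse, the lift of B
    with the conjugate of kappa.\<close>
  define lift where "lift \<mu> C = (\<lambda>w. cons_vec (\<mu> * w $ None) (C (tl_vec w)))"
    for \<mu> :: complex and C :: "complex ^ 'n \<Rightarrow> complex ^ 'n"
  have into: "lift \<mu> C w \<in> LL" if "\<And>z. sqnorm (C z) = sqnorm z" "\<And>z. qf (C z) = \<mu> * qf z" "cmod \<mu> = 1" "w \<in> LL" for \<mu> C w
  proof -
    have "\<mu> * w $ None + qf (C (tl_vec w)) = \<mu> * (w $ None + qf (tl_vec w))"
      by (simp add: that(2) distrib_left)
    then have "cmod (\<mu> * w $ None + qf (C (tl_vec w))) = cmod (w $ None + qf (tl_vec w))"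
      by (simp only: norm_mult that(3) mult_1)
    then show ?thesis
      using that(4) unfolding LL_iff lift_def lie_cond_def
      by (simp only: cons_vec_nth tl_cons_vec norm_mult that(1,3) mult_1)
  qed
  have holo: "holo_on (lift \<mu> C) LL" if "clin C" for \<mu> C
    unfolding lift_def by (rule holo_on_cons_vec) (simp_all add: hol_at_mult hol_at_clin[OF that])
  show ?thesis
  proof (rule liftsI)
    show "biholo LL (lift \<kappa> A) (lift (cnj \<kappa>) B)"
      unfolding biholo_def
    proof (intro conjI ballI holo A B)
      fix w :: "complex ^ 'n option" assume w: "w \<in> LL"
      show "lift \<kappa> A w \<in> LL" using N Q k w by (rule into)
      show "lift (cnj \<kappa>) B w \<in> LL" by (rule into) (simp_all add: NB QB k w)
      show "lift (cnj \<kappa>) B (lift \<kappa> A w) = w" "lift \<kappa> A (lift (cnj \<kappa>) B w) = w"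
        by (simp_all add: lift_def AB BA k1 k2)
    qed
    show "biholo lie_ball A B"
    proof -
      have h: "holo_on C lie_ball" if "clin C" for C :: "complex ^ 'n \<Rightarrow> complex ^ 'n"
        unfolding holo_on_componentwise using hol_at_clin[OF that, of "\<lambda>z. z"] by simp
      have "A z \<in> lie_ball" "B z \<in> lie_ball" if "z \<in> lie_ball" for z
        using that k by (auto simp: lie_ball_iff N Q NB QB lie_cond_def norm_mult)
      then show ?thesis unfolding biholo_def by (simp add: AB BA h[OF A] h[OF B])
    qed
    show "lift \<kappa> A (embed0 z) = embed0 (A z)" for z
      by (simp add: lift_def embed0_eq)
  qed
qed

lemma clin_scale: "clin (\<lambda>z. e *s z)"
  unfolding clin_def by (auto intro!: linearI simp: vec_eq_iff algebra_simps)

lemma lifts_phase: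
  assumes "cmod e = 1"
  shows "lifts (\<lambda>z. e *s z) (\<lambda>z. cnj e *s z)"
proof (rule lifts_linear[where \<kappa> = "e * e"])
  have "e * cnj e = 1" using assms by (metis complex_norm_square of_real_1 one_power2)
  then show "e *s (cnj e *s z) = z" "cnj e *s (e *s z) = z" for z
    by (simp_all add: vector_smult_assoc mult.commute)
qed (use assms in \<open>simp_all add: clin_scale sqnorm_scale bil_scale bil_scale_left norm_mult\<close>)

text \<open>A real value of a.a means that the real and imaginary parts of a are orthogonal. A boost
  along the normalised real part u then meets a real coordinate u.a and can cancel it, rescaling the
  imaginary part by a real factor.\<close>

lemma boost_kills_real_part:
  fixes a :: "complex ^ 'n::finite"
  assumes a: "a \<in> lie_ball" and im: "Im (qf a) = 0"
  shows "\<exists>f g r. lifts f g \<and> f a = (\<chi> j. \<i> * complex_of_real (r * Im (a $ j)))"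
proof -
  define A where "A = (\<Sum>j\<in>UNIV. (Re (a $ j))\<^sup>2)"
  define B where "B = (\<Sum>j\<in>UNIV. (Im (a $ j))\<^sup>2)"
  define C where "C = (\<Sum>j\<in>UNIV. Re (a $ j) * Im (a $ j))"
  have q: "Re (qf a) = A - B" "Im (qf a) = 2 * C"
    by (simp_all add: bil_def A_def B_def C_def power2_eq_square sum_subtractf sum.distrib sum_distrib_left mult_ac)
  have N: "sqnorm a = A + B"
    by (simp add: sqnorm_def A_def B_def cmod_power2 sum.distrib)
  have C: "C = 0" and qa: "qf a = complex_of_real (A - B)"
    using im q by (auto simp: complex_eq_iff)
  have AB0: "0 \<le> A" "0 \<le> B" by (simp_all add: A_def B_def sum_nonneg)
  show ?thesis
  proof (cases "A = 0")
    case True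
    then have "Re (a $ j) = 0" for j unfolding A_def by (simp add: sum_nonneg_eq_0_iff)
    then have "1 *s a = (\<chi> j. \<i> * complex_of_real (1 * Im (a $ j)))"
      by (simp add: vec_eq_iff complex_eq_iff)
    then show ?thesis using lifts_phase[of 1] by (metis norm_one)
  next
    case False
    define n where "n = sqrt A"
    have n: "n > 0" "n\<^sup>2 = A" using False AB0 by (auto simp: n_def)
    define q where "q = A - B"
    have "(cmod (qf a))\<^sup>2 = q\<^sup>2"
      by (simp only: qa q_def norm_of_real power2_abs)
    then have cond: "A + B < 1" "0 < 1 - 2 * (A + B) + q\<^sup>2"
      using a by (simp_all only: lie_ball_iff lie_cond_def N)
    have q1: "0 < 1 + q" using cond AB0 by (simp add: q_def)
    \<comment> \<open>The second Lie ball inequality in disguise, as 1 - 2 (A + B) + q^2 = (1 + q)^2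
      - 4 A. It keeps the velocity below in modulus under 1.\<close>
    have "(2 * n)\<^sup>2 < (1 + q)\<^sup>2"
    proof -
      have "(2 * n)\<^sup>2 = 4 * A" by (simp add: power_mult_distrib n(2))
      moreover have "(1 + q)\<^sup>2 = 1 + 2 * q + q\<^sup>2" by (simp add: power2_sum)
      moreover have "4 * A < 1 + 2 * q + q\<^sup>2" using cond(2) by (simp add: q_def)
      ultimately show ?thesis by (simp only:)
    qed
    then have nq: "2 * n < 1 + q"
      by (rule power2_less_imp_less) (use q1 in simp)
    \<comment> \<open>The velocity s / c that solves n + shift = 0, that is c n + s (1 + q) / 2 =
      0.\<close>
    define \<beta> where "\<beta> = - 2 * n / (1 + q)"
    have "\<bar>\<beta>\<bar> < 1" using nq n q1 by (simp add: \<beta>_def)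
    then have b: "0 < 1 - \<beta>\<^sup>2" by (simp add: abs_square_less_1)
    define c where "c = 1 / sqrt (1 - \<beta>\<^sup>2)"
    define s where "s = \<beta> * c"
    have c: "c > 0" "c\<^sup>2 * (1 - \<beta>\<^sup>2) = 1"
      using b by (auto simp: c_def power_divide)
    then have cs: "c\<^sup>2 = 1 + s\<^sup>2" by (simp add: s_def power_mult_distrib algebra_simps)
    define u where "u = (\<chi> j. complex_of_real (Re (a $ j) / n))"
    have u: "real_vec u" "sqnorm u = 1"
      using n False by (simp_all add: real_vec_def u_def sqnorm_def norm_divide power_divide sum_divide_distrib[symmetric] A_def[symmetric])
    have "bil u a = complex_of_real (A / n) + \<i> * complex_of_real (C / n)"
      by (rule complex_eqI) (simp_all add: bil_def u_def A_def C_def sum_divide_distrib power2_eq_square)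
    moreover have "A / n = n"
      unfolding n(2)[symmetric] using n(1) by (simp add: power2_eq_square)
    ultimately have t: "bil u a = complex_of_real n" by (simp only: C) simp
    have "s * (1 + q) = - 2 * n * c" using q1 by (simp add: s_def \<beta>_def)
    then have sh: "boost_shift c s n q = complex_of_real (- n)"
      unfolding boost_shift_def by (simp add: complex_eq_iff algebra_simps)
    define d where "d = (c + 1) / 2 + s * n + (c - 1) / 2 * q"
    have den: "boost_den c s n q = complex_of_real d"
      unfolding boost_den_def d_def by simp
    have "a $ j + complex_of_real (- n) * u $ j = \<i> * complex_of_real (Im (a $ j))" for j
      using n(1) by (simp add: u_def complex_eq_iff)
    then have "boost u c s a = (\<chi> j. \<i> * complex_of_real (1 / d * Im (a $ j)))"
      unfolding boost_def boost_vec_def t qa q_def[symmetric] sh den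
      by (simp add: vec_eq_iff del: vector_add_ldistrib of_real_minus)
    moreover have "lifts (boost u c s) (boost u c (- s))"
      using u cs c by (intro lifts_boost boost_data.intro)
    ultimately show ?thesis by blast
  qed
qed

text \<open>Four moves: a rotation that makes a.a real, a boost that removes the real part,
  multiplication by -i that turns the imaginary rest into a real vector, and a second boost that
  removes it.\<close>

lemma lie_ball_transitive:
  fixes a :: "complex ^ 'n::finite"
  assumes a: "a \<in> lie_ball"
  shows "\<exists>f g. lifts f g \<and> f a = 0"
proof -
  \<comment> \<open>A square root of the phase that turns a.a into its modulus; for a.a = 0 the
    trivial rotation serves.\<close>
  define e where "e = (if qf a = 0 then 1 else csqrt (cnj (qf a) / cmod (qf a)))"
  have e: "cmod e = 1" and qe: "Im (e\<^sup>2 * qf a) = 0"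
  proof -
    have "cmod e ^ 2 = 1"
      unfolding norm_power[symmetric] by (simp add: e_def norm_divide)
    then show "cmod e = 1"
      using power2_eq_imp_eq[of "cmod e" 1] by simp
    have "e\<^sup>2 * qf a = of_real (cmod (qf a))"
    proof (cases "qf a = 0")
      case False
      then have "e\<^sup>2 * qf a = qf a * cnj (qf a) / cmod (qf a)" by (simp add: e_def)
      also have "\<dots> = cmod (qf a)"
        unfolding complex_norm_square[symmetric] using False by (simp add: power2_eq_square)
      finally show ?thesis .
    qed simp
    then show "Im (e\<^sup>2 * qf a) = 0" by simp
  qed
  define a1 where "a1 = e *s a"
  have l1: "lifts (\<lambda>z. e *s z) (\<lambda>z. cnj e *s z :: complex ^ 'n)" by (rule lifts_phase[OF e])
  have a1: "a1 \<in> lie_ball" using lifts_biholo[OF l1] a biholoD(1) unfolding a1_def by blast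
  have "Im (qf a1) = 0" using qe by (simp add: a1_def bil_scale bil_scale_left power2_eq_square mult.assoc)
  then obtain f g r where l2: "lifts f g" and f: "f a1 = (\<chi> j. \<i> * complex_of_real (r * Im (a1 $ j)))"
    using boost_kills_real_part[OF a1] by blast
  define a3 where "a3 = (- \<i>) *s f a1"
  have l3: "lifts (\<lambda>z. (- \<i>) *s z) (\<lambda>z. cnj (- \<i>) *s z :: complex ^ 'n)" by (rule lifts_phase) simp
  have "f a1 \<in> lie_ball" using lifts_biholo[OF l2] a1 biholoD(1) by blast
  then have a3: "a3 \<in> lie_ball" using lifts_biholo[OF l3] biholoD(1) unfolding a3_def by blast
  have re: "Im (a3 $ j) = 0" for j by (simp add: a3_def f)
  then have "Im (qf a3) = 0" using real_vec_qf[of a3] by (simp add: real_vec_def)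
  then obtain f' g' r' where l4: "lifts f' g'" and f': "f' a3 = (\<chi> j. \<i> * complex_of_real (r' * Im (a3 $ j)))"
    using boost_kills_real_part[OF a3] by blast
  have "f' a3 = 0" by (simp add: f' re vec_eq_iff)
  then show ?thesis
    using lifts_compose[OF lifts_compose[OF lifts_compose[OF l1 l2] l3] l4] unfolding a3_def a1_def by blast
qed

section \<open>Automorphisms fixing the origin\<close>

definition herm :: "complex ^ 'm::finite \<Rightarrow> complex ^ 'm \<Rightarrow> complex" where
  "herm z w = (\<Sum>j\<in>UNIV. z $ j * cnj (w $ j))"

lemma herm_self: "herm z z = complex_of_real (sqnorm z)"
  by (simp add: herm_def sqnorm_cnj)

lemma herm_scale_right: "herm z (c *s w) = cnj c * herm z w"
  by (simp add: herm_def sum_distrib_left mult_ac)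

lemma norm_herm_le: "cmod (herm z w) \<le> norm z * norm w"
proof -
  have "cmod (herm z w) \<le> (\<Sum>j\<in>UNIV. \<bar>cmod (z $ j)\<bar> * \<bar>cmod (w $ j)\<bar>)"
    unfolding herm_def by (rule sum_norm_le) (simp add: norm_mult)
  also have "\<dots> \<le> L2_set (\<lambda>j. cmod (z $ j)) UNIV * L2_set (\<lambda>j. cmod (w $ j)) UNIV"
    by (rule L2_set_mult_ineq)
  finally show ?thesis by (simp add: norm_vec_def)
qed

lemma sqnorm_diff_scale:
  "sqnorm (a - c *s v) = sqnorm a - 2 * Re (cnj c * herm a v) + (cmod c)\<^sup>2 * sqnorm v"
proof -
  have "(cmod (a $ j - c * v $ j))\<^sup>2 =
      (cmod (a $ j))\<^sup>2 - 2 * Re (cnj c * (a $ j * cnj (v $ j))) + (cmod c)\<^sup>2 * (cmod (v $ j))\<^sup>2" for j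
    unfolding cmod_power2 by (simp add: power2_eq_square algebra_simps)
  then have "sqnorm (a - c *s v) = (\<Sum>j\<in>UNIV. (cmod (a $ j))\<^sup>2) -
      (\<Sum>j\<in>UNIV. 2 * Re (cnj c * (a $ j * cnj (v $ j)))) + (\<Sum>j\<in>UNIV. (cmod c)\<^sup>2 * (cmod (v $ j))\<^sup>2)"
    by (simp add: sqnorm_def sum.distrib sum_subtractf)
  also have "(\<Sum>j\<in>UNIV. 2 * Re (cnj c * (a $ j * cnj (v $ j)))) = 2 * Re (cnj c * herm a v)"
    unfolding herm_def by (simp only: sum_distrib_left Re_sum)
  finally show ?thesis
    by (simp add: sqnorm_def sum_distrib_left)
qed

lemma norm_scale_complex: "norm (c *s (v :: complex ^ 'm::finite)) = cmod c * norm v"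
  by (simp add: norm_vec_def L2_set_def norm_mult power_mult_distrib real_sqrt_mult flip: sum_distrib_left)

lemma exists_norming_vector:
  fixes v :: "complex ^ 'm::finite"
  assumes "v \<noteq> 0"
  shows "\<exists>w. norm w = 1 \<and> herm v w = norm v"
proof (intro exI conjI)
  let ?w = "complex_of_real (1 / norm v) *s v"
  show "norm ?w = 1" using assms by (simp add: norm_scale_complex norm_divide)
  show "herm v ?w = norm v"
    unfolding herm_scale_right herm_self sqnorm_eq_norm using assms by (simp add: power2_eq_square)
qed

text \<open>Pairing phi with a unit vector w gives a self-map of the disc. Choosing w to attain the
  norm of v, or of phi(zeta), yields |v| <= 1 and |phi(zeta)| <= |zeta|; the equality case takes w =
  v.\<close>

lemma vector_Schwarz:
  fixes \<phi> :: "complex \<Rightarrow> complex ^ 'm::finite"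
  assumes hol: "\<And>j. (\<lambda>\<zeta>. \<phi> \<zeta> $ j) holomorphic_on ball 0 1" and 0: "\<phi> 0 = 0"
    and lt: "\<And>\<zeta>. cmod \<zeta> < 1 \<Longrightarrow> norm (\<phi> \<zeta>) < 1"
    and D: "\<And>j. ((\<lambda>\<zeta>. \<phi> \<zeta> $ j) has_field_derivative v $ j) (at 0)"
  shows "norm v \<le> 1" and "norm v = 1 \<Longrightarrow> cmod \<zeta> < 1 \<Longrightarrow> \<phi> \<zeta> = \<zeta> *s v"
proof -
  define g where "g w \<zeta> = herm (\<phi> \<zeta>) w" for w \<zeta>
  have Dg: "(g w has_field_derivative herm v w) (at 0)" for w
    unfolding g_def[abs_def] herm_def by (intro DERIV_sum DERIV_cmult_right D)
  have g: "g w holomorphic_on ball 0 1" "g w 0 = 0" "\<And>\<zeta>. norm \<zeta> < 1 \<Longrightarrow> norm (g w \<zeta>) < 1" if "norm w = 1" for w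
  proof -
    show "g w holomorphic_on ball 0 1"
      unfolding g_def[abs_def] herm_def by (intro holomorphic_intros hol)
    show "g w 0 = 0" by (simp add: g_def herm_def 0)
    show "norm (g w \<zeta>) < 1" if "norm \<zeta> < 1" for \<zeta>
      using norm_herm_le[of "\<phi> \<zeta>" w] lt[OF that] \<open>norm w = 1\<close> by (simp add: g_def)
  qed
  note S = Schwarz_Lemma[OF g]
  show "norm v \<le> 1"
  proof (cases "v = 0")
    case False
    then obtain w where w: "norm w = 1" "herm v w = norm v" using exists_norming_vector by blast
    have "norm (deriv (g w) 0) \<le> 1" by (rule S(2)[OF w(1) w(1) w(1), of 0]) auto
    then show ?thesis using DERIV_imp_deriv[OF Dg, of w] w by simp
  qed simp
  have le: "norm (\<phi> \<zeta>) \<le> cmod \<zeta>" if "cmod \<zeta> < 1" for \<zeta>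
  proof (cases "\<phi> \<zeta> = 0")
    case False
    then obtain w where w: "norm w = 1" "herm (\<phi> \<zeta>) w = norm (\<phi> \<zeta>)" using exists_norming_vector by blast
    have "norm (g w \<zeta>) \<le> norm \<zeta>" by (rule S(1)[OF w(1) w(1) w(1)]) (use that in auto)
    then show ?thesis using w by (simp add: g_def)
  qed simp
  show "\<phi> \<zeta> = \<zeta> *s v" if v: "norm v = 1" and \<zeta>: "cmod \<zeta> < 1" for \<zeta>
  proof -
    \<comment> \<open>The scalar equality case gives \<open>herm\<close> of phi(zeta) and v as alpha
      zeta, where alpha = |v|^2 = 1. Then |phi(zeta) - zeta v|^2 = |phi(zeta)|^2 - |zeta|^2, which
      is at most 0.\<close>
    have vv: "herm v v = 1" by (simp add: herm_self sqnorm_eq_norm v)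
    have "norm (deriv (g v) 0) = 1" using DERIV_imp_deriv[OF Dg, of v] vv by simp
    then have "\<exists>\<alpha>. (\<forall>z. norm z < 1 \<longrightarrow> g v z = \<alpha> * z) \<and> norm \<alpha> = 1"
      by (intro S(3)[OF v v v, of 0]) auto
    then obtain \<alpha> where \<alpha>: "\<And>z. norm z < 1 \<Longrightarrow> g v z = \<alpha> * z" by blast
    have "(g v has_field_derivative \<alpha>) (at 0)"
    proof (rule has_field_derivative_transform_within_open[of "\<lambda>z. \<alpha> * z" _ _ "ball 0 1"])
      show "((*) \<alpha> has_field_derivative \<alpha>) (at 0)" by (auto intro!: derivative_eq_intros)
    qed (auto simp: \<alpha>)
    then have "\<alpha> = 1" using DERIV_unique Dg[of v] vv by metis
    then have "herm (\<phi> \<zeta>) v = \<zeta>" using \<alpha>[OF \<zeta>] by (simp add: g_def)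
    moreover have "Re (cnj \<zeta> * \<zeta>) = (cmod \<zeta>)\<^sup>2"
      unfolding cmod_power2 by (simp add: power2_eq_square)
    moreover have "sqnorm v = 1" by (simp add: sqnorm_eq_norm v)
    ultimately have "sqnorm (\<phi> \<zeta> - \<zeta> *s v) = sqnorm (\<phi> \<zeta>) - 2 * (cmod \<zeta>)\<^sup>2 + (cmod \<zeta>)\<^sup>2 * 1"
      unfolding sqnorm_diff_scale by (simp only:)
    also have "\<dots> = (norm (\<phi> \<zeta>))\<^sup>2 - (cmod \<zeta>)\<^sup>2" by (simp add: sqnorm_eq_norm)
    also have "\<dots> \<le> 0" using power_mono[OF le[OF \<zeta>], of 2] by simp
    finally show ?thesis by (simp add: sqnorm_eq_norm)
  qed
qed

text \<open>At z = zeta x with x real, |z.z| = |z|^2, and the second inequality becomes (1 -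
  |zeta|^2)^2 > 0. Discs in real directions thus reach the unit sphere, which gives the Schwarz
  lemma its full strength there.\<close>

lemma real_disc_in_lie_ball:
  assumes "real_vec x" "sqnorm x = 1" "cmod \<zeta> < 1"
  shows "\<zeta> *s x \<in> lie_ball"
proof -
  have q: "sqnorm (\<zeta> *s x) = (cmod \<zeta>)\<^sup>2" "cmod (qf (\<zeta> *s x)) = (cmod \<zeta>)\<^sup>2"
    using real_vec_qf[OF assms(1)] assms(2)
    by (simp_all add: sqnorm_scale bil_scale bil_scale_left norm_mult power2_eq_square)
  have r: "(cmod \<zeta>)\<^sup>2 < 1" using assms(3) by (simp add: power_less_one_iff)
  then have "0 < (1 - (cmod \<zeta>)\<^sup>2)\<^sup>2" by simp
  then have "0 < 1 - 2 * (cmod \<zeta>)\<^sup>2 + ((cmod \<zeta>)\<^sup>2)\<^sup>2" unfolding power2_diff by simp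
  then show ?thesis unfolding lie_ball_iff lie_cond_def q using r by blast
qed

lemma zero_in_lie_ball: "0 \<in> lie_ball"
  by (simp add: lie_ball_iff lie_cond_def sqnorm_def bil_def)

text \<open>For the matrices a of A and b of B, the sum of |a_jk - cnj b_kj|^2 equals the squared
  norms of all columns of both minus twice the real part of the trace of BA, which is at most n + n
  - 2n = 0. Hence B is the adjoint of A.\<close>

lemma unitary_of_column_bounds:
  fixes A B :: "complex ^ 'n::finite \<Rightarrow> complex ^ 'n"
  assumes A: "clin A" and B: "clin B" and BA: "\<And>z. B (A z) = z"
    and A1: "\<And>k. sqnorm (A (axis k 1)) \<le> 1" and B1: "\<And>k. sqnorm (B (axis k 1)) \<le> 1"
  shows "sqnorm (A z) = sqnorm z"
proof -
  define a where "a j k = A (axis k 1) $ j" for j k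
  define b where "b k j = B (axis j 1) $ k" for k j
  have ba: "(\<Sum>j\<in>UNIV. a j k * b k j) = 1" for k
    using clin_expand[OF B, of "A (axis k 1)" k] BA by (simp add: a_def b_def)
  have sq: "(cmod (a j k - cnj (b k j)))\<^sup>2 = (cmod (a j k))\<^sup>2 + (cmod (b k j))\<^sup>2 - 2 * Re (a j k * b k j)" for j k
    unfolding cmod_power2 by (simp add: power2_eq_square algebra_simps)
  have "(\<Sum>k\<in>UNIV. \<Sum>j\<in>UNIV. (cmod (a j k - cnj (b k j)))\<^sup>2) =
      (\<Sum>k\<in>UNIV. \<Sum>j\<in>UNIV. (cmod (a j k))\<^sup>2) + (\<Sum>k\<in>UNIV. \<Sum>j\<in>UNIV. (cmod (b k j))\<^sup>2)
      - 2 * (\<Sum>k\<in>UNIV. Re (\<Sum>j\<in>UNIV. a j k * b k j))"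
    unfolding sq by (simp only: sum.distrib sum_subtractf sum_distrib_left Re_sum)
  also have "(\<Sum>k\<in>UNIV. \<Sum>j\<in>UNIV. (cmod (b k j))\<^sup>2) = (\<Sum>j\<in>UNIV. sqnorm (B (axis j 1)))"
    unfolding sqnorm_def b_def by (rule sum.swap)
  also have "(\<Sum>k\<in>UNIV. \<Sum>j\<in>UNIV. (cmod (a j k))\<^sup>2) = (\<Sum>k\<in>UNIV. sqnorm (A (axis k 1)))"
    unfolding sqnorm_def a_def ..
  also have "(\<Sum>k\<in>UNIV. sqnorm (A (axis k 1))) + (\<Sum>j\<in>UNIV. sqnorm (B (axis j 1)))
      - 2 * (\<Sum>k\<in>UNIV. Re (\<Sum>j\<in>UNIV. a j k * b k j)) \<le> 0"
    using sum_mono[of UNIV "\<lambda>k. sqnorm (A (axis k 1))" "\<lambda>_. 1", OF A1]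
      sum_mono[of UNIV "\<lambda>k. sqnorm (B (axis k 1))" "\<lambda>_. 1", OF B1] by (simp add: ba)
  finally have "(\<Sum>k\<in>UNIV. \<Sum>j\<in>UNIV. (cmod (a j k - cnj (b k j)))\<^sup>2) = 0"
    by (intro order_antisym sum_nonneg) auto
  then have eq: "cnj (a j k) = b k j" for j k
    by (simp add: sum_nonneg_eq_0_iff sum_nonneg)
  have "complex_of_real (sqnorm (A z)) = (\<Sum>j\<in>UNIV. A z $ j * cnj (\<Sum>k\<in>UNIV. z $ k * a j k))"
    unfolding sqnorm_cnj a_def clin_expand[OF A, symmetric] ..
  also have "\<dots> = (\<Sum>j\<in>UNIV. \<Sum>k\<in>UNIV. cnj (z $ k) * (A z $ j * b k j))"
    by (simp add: sum_distrib_left eq mult_ac)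
  also have "\<dots> = (\<Sum>k\<in>UNIV. cnj (z $ k) * B (A z) $ k)"
    unfolding clin_expand[OF B, of "A z"] b_def sum_distrib_left by (rule sum.swap)
  also have "\<dots> = complex_of_real (sqnorm z)"
    unfolding sqnorm_cnj BA by (simp add: mult.commute)
  finally show ?thesis by simp
qed

lemma derivative_at_fixed_point:
  assumes fg: "biholo lie_ball f g" and f0: "f 0 = 0"
  shows "\<exists>A B. (f has_derivative A) (at 0) \<and> (g has_derivative B) (at 0) \<and> clin A \<and> clin B \<and>
    (\<forall>v. A (B v) = v) \<and> (\<forall>v. B (A v) = v)"
proof -
  have g0: "g 0 = 0" using biholoD(3)[OF fg zero_in_lie_ball] f0 by simp
  have ex: "\<exists>L. (k has_derivative L) (at 0) \<and> clin L" if k: "holo_on k lie_ball" for k :: "complex ^ 'a \<Rightarrow> complex ^ 'a"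
  proof -
    obtain L where L: "(k has_derivative L) (at 0)" "\<And>v. L (\<i> *s v) = \<i> *s L v"
      using k zero_in_lie_ball unfolding holo_on_def by blast
    then have "clin L"
      unfolding clin_def using has_derivative_linear clinear_imaginary by blast
    then show ?thesis using L(1) by blast
  qed
  obtain A where A: "(f has_derivative A) (at 0)" "clin A" using ex[of f] fg by (auto simp: biholo_def)
  obtain B where B: "(g has_derivative B) (at 0)" "clin B" using ex[of g] fg by (auto simp: biholo_def)
  have inv: "M (L v) = v" if "(k has_derivative L) (at 0)" "(l has_derivative M) (at (k 0))"
    "\<And>z. z \<in> lie_ball \<Longrightarrow> l (k z) = z" for k l L M and v :: "complex ^ 'a"
  proof -
    have "((\<lambda>z. l (k z)) has_derivative (\<lambda>v. M (L v))) (at 0)"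
      by (rule has_derivative_compose[OF that(1,2)])
    then have "((\<lambda>z. z) has_derivative (\<lambda>v. M (L v))) (at 0)"
      using has_derivative_transform_within_open[of "\<lambda>z. l (k z)" _ 0 UNIV lie_ball "\<lambda>z. z"]
        open_lie_ball zero_in_lie_ball that(3) by auto
    then have "(\<lambda>v. M (L v)) = (\<lambda>v. v)"
      by (rule has_derivative_unique[OF _ has_derivative_ident])
    then show ?thesis by meson
  qed
  have "B (A v) = v" "A (B v) = v" for v
    using inv[OF A(1), of g B] inv[OF B(1), of f A] B(1) A(1) f0 g0 biholoD(3,4)[OF fg] by auto
  then show ?thesis using A B by blast
qed

section \<open>Rigidity from real directions\<close>

lemma norm_less_one_lie_ball: "z \<in> lie_ball \<Longrightarrow> norm z < 1"
  by (simp add: lie_ball_iff lie_cond_def sqnorm_eq_norm power_less_one_iff)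

text \<open>The multiples zeta x with |zeta| < 1 all lie in the Lie ball, and the values of f lie in
  the Euclidean unit ball, so \<open>vector_Schwarz\<close> applies to zeta -> f (zeta x) with
  derivative A x.\<close>

lemma real_direction_Schwarz:
  assumes f: "holo_on f lie_ball" "f ` lie_ball \<subseteq> lie_ball" "f 0 = 0"
    and A: "(f has_derivative A) (at 0)" and x: "real_vec x" "sqnorm x = 1"
  shows "norm (A x) \<le> 1" and "norm (A x) = 1 \<Longrightarrow> cmod \<zeta> < 1 \<Longrightarrow> f (\<zeta> *s x) = \<zeta> *s A x"
proof -
  have 1: "(\<lambda>\<zeta>. f (\<zeta> *s x) $ j) holomorphic_on ball 0 1" for j
    using holo_on_line(1)[OF f(1), of 0 x j] real_disc_in_lie_ball[OF x]
    by (auto elim: holomorphic_on_subset)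
  have 2: "f (0 *s x) = 0" by (simp add: f(3))
  have 3: "norm (f (\<zeta> *s x)) < 1" if "cmod \<zeta> < 1" for \<zeta>
    using real_disc_in_lie_ball[OF x that] f(2) by (intro norm_less_one_lie_ball) blast
  note 4 = holo_on_line(2)[OF f(1) zero_in_lie_ball A]
  show "norm (A x) \<le> 1" by (rule vector_Schwarz(1)[OF 1 2 3 4])
  show "norm (A x) = 1 \<Longrightarrow> cmod \<zeta> < 1 \<Longrightarrow> f (\<zeta> *s x) = \<zeta> *s A x"
    by (rule vector_Schwarz(2)[OF 1 2 3 4])
qed

text \<open>With X, Y, D the Gram entries of x and y, the second inequality is (1 - (X + t^2 Y))^2 >
  4 t^2 (X Y - D^2). Lowering t from 1 can only raise the left side and, as D^2 <= X Y, only lower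
  the right.\<close>

lemma lie_ball_segment:
  fixes x y :: "complex ^ 'm::finite"
  assumes x: "real_vec x" and y: "real_vec y" and z: "x + \<i> *s y \<in> lie_ball" and t: "0 \<le> t" "t \<le> 1"
  shows "x + (\<i> * complex_of_real t) *s y \<in> lie_ball"
proof -
  define X where "X = (\<Sum>j\<in>UNIV. (Re (x $ j))\<^sup>2)"
  define Y where "Y = (\<Sum>j\<in>UNIV. (Re (y $ j))\<^sup>2)"
  define D where "D = (\<Sum>j\<in>UNIV. Re (x $ j) * Re (y $ j))"
  have im: "Im (x $ j) = 0" "Im (y $ j) = 0" for j using x y by (auto simp: real_vec_def)
  have N: "sqnorm (x + (\<i> * complex_of_real t) *s y) = X + t\<^sup>2 * Y" for t
    by (simp add: sqnorm_def cmod_power2 im X_def Y_def sum.distrib sum_distrib_left power_mult_distrib)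
  have xx: "qf x = of_real X" "qf y = of_real Y" "bil x y = of_real D"
    by (simp_all add: bil_def X_def Y_def D_def complex_eq_iff im power2_eq_square)
  have "qf (x + (\<i> * complex_of_real t) *s y) = of_real (X - t\<^sup>2 * Y) + \<i> * of_real (2 * t * D)" for t
    by (simp add: bil_simps xx bil_commute[of y x] algebra_simps power2_eq_square)
  then have Q: "(cmod (qf (x + (\<i> * complex_of_real t) *s y)))\<^sup>2 = (X - t\<^sup>2 * Y)\<^sup>2 + (2 * t * D)\<^sup>2" for t
    by (simp add: cmod_power2)
  have G: "D\<^sup>2 \<le> X * Y" unfolding X_def Y_def D_def by (rule Cauchy_Schwarz_ineq_sum)
  have rho: "1 - 2 * (X + t\<^sup>2 * Y) + ((X - t\<^sup>2 * Y)\<^sup>2 + (2 * t * D)\<^sup>2) =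
      (1 - (X + t\<^sup>2 * Y))\<^sup>2 - 4 * (t\<^sup>2 * (X * Y - D\<^sup>2))" for t
    by (simp add: power2_eq_square algebra_simps)
  have z1: "X + Y < 1" "0 < (1 - (X + Y))\<^sup>2 - 4 * (X * Y - D\<^sup>2)"
    using z N[of 1] Q[of 1] rho[of 1] by (simp_all add: lie_ball_iff lie_cond_def)
  have t2: "0 \<le> t\<^sup>2" "t\<^sup>2 \<le> 1" using t by (simp_all add: power_le_one)
  have Y0: "0 \<le> Y" unfolding Y_def by (simp add: sum_nonneg)
  have le: "X + t\<^sup>2 * Y \<le> X + Y" using mult_right_mono[OF t2(2) Y0] by simp
  have "(1 - (X + Y))\<^sup>2 \<le> (1 - (X + t\<^sup>2 * Y))\<^sup>2" using le z1(1) by (intro power_mono) auto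
  moreover have "t\<^sup>2 * (X * Y - D\<^sup>2) \<le> X * Y - D\<^sup>2"
    using mult_right_mono[OF t2(2), of "X * Y - D\<^sup>2"] G by simp
  moreover have "0 < a' - 4 * b'" if "a \<le> a'" "b' \<le> b" "0 < a - 4 * b" for a a' b b' :: real
    using that by linarith
  ultimately have "0 < (1 - (X + t\<^sup>2 * Y))\<^sup>2 - 4 * (t\<^sup>2 * (X * Y - D\<^sup>2))"
    using z1(2) by blast
  then show ?thesis
    unfolding lie_ball_iff lie_cond_def N Q rho using le z1(1) by simp
qed

text \<open>The identity theorem on the complex line zeta -> x + zeta y, where z = x + i y: real
  zeta give real points, and zeta = i gives z.\<close>

lemma eq_if_eq_on_real_points:
  fixes f A :: "complex ^ 'm::finite \<Rightarrow> complex ^ 'k::finite"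
  assumes f: "holo_on f lie_ball" and A: "holo_on A lie_ball"
    and eq: "\<And>x. real_vec x \<Longrightarrow> x \<in> lie_ball \<Longrightarrow> f x = A x" and z: "z \<in> lie_ball"
  shows "f z = A z"
proof -
  define x :: "complex ^ 'm" where "x = (\<chi> j. complex_of_real (Re (z $ j)))"
  define y :: "complex ^ 'm" where "y = (\<chi> j. complex_of_real (Im (z $ j)))"
  have xy: "real_vec x" "real_vec y" "z = x + \<i> *s y"
    by (auto simp: real_vec_def x_def y_def vec_eq_iff complex_eq_iff)
  define U where "U = {\<zeta>. x + \<zeta> *s y \<in> lie_ball}"
  have cont: "continuous_on UNIV (\<lambda>\<zeta>. x + \<zeta> *s y)"
    unfolding vector_scalar_mult_def by (intro continuous_intros)
  have "open U"
    using open_vimage[OF open_lie_ball cont] by (simp add: U_def vimage_def)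
  have "closed_segment 0 \<i> \<subseteq> U"
  proof
    fix \<zeta> assume "\<zeta> \<in> closed_segment 0 \<i>"
    then obtain t where "0 \<le> t" "t \<le> 1" "\<zeta> = \<i> * complex_of_real t"
      by (auto simp: closed_segment_def scaleR_conv_of_real mult.commute)
    then show "\<zeta> \<in> U" using lie_ball_segment[OF xy(1,2)] z xy(3) by (auto simp: U_def)
  qed
  \<comment> \<open>The identity theorem needs a connected open set; the component of 0 contains i
    because the segment between them stays in U.\<close>
  define W where "W = connected_component_set U 0"
  have 0: "0 \<in> U" using \<open>closed_segment 0 \<i> \<subseteq> U\<close> by auto
  have W: "open W" "connected W" "W \<subseteq> U" "0 \<in> W" "\<i> \<in> W"
  proof -
    show "open W" unfolding W_def by (rule open_connected_component[OF \<open>open U\<close>])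
    show "connected W" unfolding W_def by (rule connected_connected_component)
    show "W \<subseteq> U" unfolding W_def by (rule connected_component_subset)
    have "closed_segment 0 \<i> \<subseteq> W" unfolding W_def
      by (rule connected_component_maximal) (use \<open>closed_segment 0 \<i> \<subseteq> U\<close> in auto)
    then show "0 \<in> W" "\<i> \<in> W" by auto
  qed
  have lim: "0 islimpt (W \<inter> \<real>)"
    unfolding islimpt_approachable
  proof (intro allI impI)
    fix e :: real assume "0 < e"
    obtain d where d: "d > 0" "ball 0 d \<subseteq> W" using W(1,4) openE by blast
    define r where "r = min e d / 2"
    have r: "0 < r" "r < e" "r < d" using \<open>0 < e\<close> d by (auto simp: r_def)
    have "complex_of_real r \<in> W" using d r by (intro subsetD[OF d(2)]) auto
    then show "\<exists>x'\<in>W \<inter> \<real>. x' \<noteq> 0 \<and> dist x' 0 < e"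
      using r by (intro bexI[of _ "complex_of_real r"]) auto
  qed
  have "f (x + \<i> *s y) $ j - A (x + \<i> *s y) $ j = 0" for j
  proof (rule analytic_continuation[of "\<lambda>\<zeta>. f (x + \<zeta> *s y) $ j - A (x + \<zeta> *s y) $ j" W "W \<inter> \<real>" 0])
    show "(\<lambda>\<zeta>. f (x + \<zeta> *s y) $ j - A (x + \<zeta> *s y) $ j) holomorphic_on W"
      using holo_on_line(1)[OF f, of x y j] holo_on_line(1)[OF A, of x y j] W(3)
      unfolding U_def by (intro holomorphic_on_diff) (auto elim: holomorphic_on_subset)
    fix \<zeta> assume \<zeta>: "\<zeta> \<in> W \<inter> \<real>"
    then have "real_vec (x + \<zeta> *s y)" using xy(1,2) by (auto simp: real_vec_def complex_is_Real_iff)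
    then show "f (x + \<zeta> *s y) $ j - A (x + \<zeta> *s y) $ j = 0"
      using eq \<zeta> W(3) by (auto simp: U_def)
  qed (use W lim in auto)
  then show ?thesis by (simp add: xy(3) vec_eq_iff)
qed

text \<open>At fixed \<open>sqnorm\<close>, the point with smaller |z.z| leaves the Lie ball sooner
  under scaling. If A decreased |z.z|, some multiple of z inside the ball would have its image on
  the boundary.\<close>

lemma qf_le_of_preserves_lie_ball:
  fixes A :: "complex ^ 'n::finite \<Rightarrow> complex ^ 'n"
  assumes A: "clin A" and N: "\<And>z. sqnorm (A z) = sqnorm z"
    and ball: "\<And>z. z \<in> lie_ball \<Longrightarrow> A z \<in> lie_ball"
  shows "cmod (qf z) \<le> cmod (qf (A z))"
proof (rule ccontr)
  assume "\<not> cmod (qf z) \<le> cmod (qf (A z))"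
  define n m where "n = sqnorm z" and "m = cmod (qf (A z))"
  have m: "0 \<le> m" "m < cmod (qf z)" "cmod (qf z) \<le> n"
    using \<open>\<not> cmod (qf z) \<le> cmod (qf (A z))\<close> cmod_qf_le[of z] by (auto simp: n_def m_def)
  \<comment> \<open>scale by the \<open>t\<close> that puts \<open>t A z\<close> on the boundary of the Lie ball\<close>
  define s where "s = sqrt (n\<^sup>2 - m\<^sup>2)"
  have "m\<^sup>2 < n\<^sup>2" using m by (intro power_strict_mono) auto
  then have s: "0 < s" "s\<^sup>2 = n\<^sup>2 - m\<^sup>2" by (auto simp: s_def)
  \<comment> \<open>The smaller root of 1 - 2 n r + m^2 r^2 = 0, in a form that stays meaningful for
    m = 0.\<close>
  define r where "r = 1 / (n + s)"
  have ns: "0 < n + s" using m s by simp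
  have r: "0 < r" "r * n < 1" using ns s by (auto simp: r_def field_simps)
  have "r * (n + s) = 1" using ns by (simp add: r_def)
  then have root: "1 - 2 * (r * n) + (r * m)\<^sup>2 = 0"
    using s(2) by algebra
  define t where "t = complex_of_real (sqrt r)"
  have t: "(cmod t)\<^sup>2 = r" using r by (simp add: t_def)
  have q: "(cmod (qf (t *s w)))\<^sup>2 = (r * cmod (qf w))\<^sup>2" for w :: "complex ^ 'n"
  proof -
    have "cmod (qf (t *s w)) = (cmod t)\<^sup>2 * cmod (qf w)"
      by (simp add: bil_scale bil_scale_left norm_mult power2_eq_square)
    then show ?thesis by (simp only: t)
  qed
  have "r * m < r * cmod (qf z)" using m r by simp
  then have "(r * m)\<^sup>2 < (r * cmod (qf z))\<^sup>2" using m r by (intro power_strict_mono) auto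
  then have "t *s z \<in> lie_ball"
    using r root unfolding lie_ball_iff lie_cond_def sqnorm_scale q t n_def[symmetric] by simp
  then have "t *s A z \<in> lie_ball"
    using ball[of "t *s z"] A by (simp add: clin_def)
  then show False
    using root unfolding lie_ball_iff lie_cond_def sqnorm_scale q t N n_def[symmetric] m_def[symmetric] by simp
qed

lemma clin_bil:
  assumes "clin A"
  shows "bil w (A v) = (\<Sum>k\<in>UNIV. v $ k * bil w (A (axis k 1)))"
proof -
  have "bil w (A v) = (\<Sum>j\<in>UNIV. \<Sum>k\<in>UNIV. v $ k * (w $ j * A (axis k 1) $ j))"
    unfolding bil_def clin_expand[OF assms, of v] by (simp add: sum_distrib_left mult_ac)
  also have "\<dots> = (\<Sum>k\<in>UNIV. v $ k * bil w (A (axis k 1)))"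
    unfolding bil_def sum_distrib_left by (rule sum.swap)
  finally show ?thesis .
qed

text \<open>A preserves null vectors. Testing e_j + i e_k and e_j - i e_k forces the Gram matrix M
  of the images to be a scalar matrix.\<close>

lemma qf_proportional:
  fixes A :: "complex ^ 'n::finite \<Rightarrow> complex ^ 'n"
  assumes A: "clin A" and Q: "\<And>z. cmod (qf (A z)) = cmod (qf z)"
  shows "\<exists>\<kappa>. cmod \<kappa> = 1 \<and> (\<forall>z. qf (A z) = \<kappa> * qf z)"
proof -
  define e :: "'n \<Rightarrow> complex ^ 'n" where "e k = axis k 1" for k
  define M where "M j k = bil (A (e j)) (A (e k))" for j k
  have e: "bil (e j) (e k) = (if j = k then 1 else 0)" for j k
  proof -
    have "e j $ i * e k $ i = (if i = j then (if j = k then 1 else 0) else 0)" for i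
      by (auto simp: e_def axis_def)
    then show ?thesis by (simp add: bil_def)
  qed
  have M: "M j k = 0 \<and> M j j = M k k" if jk: "j \<noteq> k" for j k
  proof -
    have *: "M j j + 2 * c * M j k + c\<^sup>2 * M k k = 0" if "c\<^sup>2 = -1" for c
    proof -
      have "qf (e j + c *s e k) = 0"
        using jk that by (simp add: bil_simps e power2_eq_square)
      then have "qf (A (e j + c *s e k)) = 0" using Q by (metis norm_eq_zero)
      then show ?thesis
        using A by (simp add: clin_def linear_add bil_simps M_def bil_commute[of "A (e k)" "A (e j)"]
            algebra_simps power2_eq_square)
    qed
    show ?thesis using *[of \<i>] *[of "- \<i>"] by (auto simp: complex_eq_iff)
  qed
  \<comment> \<open>An arbitrary index: all diagonal entries of M agree, so any of them serves as
    kappa.\<close>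
  obtain i :: 'n where True by simp
  define \<kappa> where "\<kappa> = M i i"
  have Mk: "M j k = (if j = k then \<kappa> else 0)" for j k
    using M[of j k] M[of j i] unfolding \<kappa>_def by (cases "j = i") auto
  have "cmod \<kappa> = 1" using Q[of "e i"] by (simp add: \<kappa>_def M_def e)
  moreover have "qf (A z) = \<kappa> * qf z" for z
  proof -
    have "bil (A (e k)) (A z) = z $ k * \<kappa>" for k
    proof -
      have "bil (A (e k)) (A z) = (\<Sum>j\<in>UNIV. z $ j * M k j)"
        unfolding M_def e_def by (rule clin_bil[OF A])
      moreover have "z $ j * M k j = (if k = j then z $ j * \<kappa> else 0)" for j by (simp add: Mk)
      ultimately show ?thesis by simp
    qed
    then have "bil (A z) (A (e k)) = z $ k * \<kappa>" for k by (simp only: bil_commute[of "A z"])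
    moreover have "qf (A z) = (\<Sum>k\<in>UNIV. z $ k * bil (A z) (A (e k)))"
      unfolding e_def by (rule clin_bil[OF A])
    ultimately show ?thesis
      by (simp add: bil_def[of z z] sum_distrib_left mult_ac)
  qed
  ultimately show ?thesis by blast
qed

lemma lifts_fixing_origin:
  fixes f g :: "complex ^ 'n::finite \<Rightarrow> complex ^ 'n"
  assumes fg: "biholo lie_ball f g" and f0: "f 0 = 0"
  shows "lifts f g"
proof -
  have g0: "g 0 = 0" using biholoD(3)[OF fg zero_in_lie_ball] f0 by simp
  obtain A B where A: "(f has_derivative A) (at 0)" "clin A" and B: "(g has_derivative B) (at 0)" "clin B"
    and AB: "\<And>v. A (B v) = v" and BA: "\<And>v. B (A v) = v"
    using derivative_at_fixed_point[OF fg f0] by blast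
  have f: "holo_on f lie_ball" "f ` lie_ball \<subseteq> lie_ball" and g: "holo_on g lie_ball" "g ` lie_ball \<subseteq> lie_ball"
    using fg by (auto simp: biholo_def)
  note fS = real_direction_Schwarz[OF f f0 A(1)]
  note gS = real_direction_Schwarz[OF g g0 B(1)]
  have e: "real_vec (axis k 1)" "sqnorm (axis k 1) = 1" for k :: 'n
  proof -
    show "real_vec (axis k 1)" by (auto simp: real_vec_def axis_def)
    have "(cmod (axis k (1 :: complex) $ j))\<^sup>2 = (if j = k then 1 else 0)" for j
      by (simp add: axis_def)
    then show "sqnorm (axis k 1) = 1" by (simp add: sqnorm_def)
  qed
  have A1: "sqnorm (A (axis k 1)) \<le> 1" and B1: "sqnorm (B (axis k 1)) \<le> 1" for k
    using fS(1)[OF e] gS(1)[OF e] by (simp_all add: sqnorm_eq_norm power_le_one)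
  have NA: "sqnorm (A z) = sqnorm z" and NB: "sqnorm (B z) = sqnorm z" for z
    by (rule unitary_of_column_bounds[OF A(2) B(2) BA A1 B1], rule unitary_of_column_bounds[OF B(2) A(2) AB B1 A1])
  \<comment> \<open>Stated for a general pair because it is needed for g as well: linearity of g
    supplies the reverse estimate for |z.z|.\<close>
  have lin: "k z = L z"
    if k: "holo_on k lie_ball" and L: "clin L" and NL: "\<And>z. sqnorm (L z) = sqnorm z" and k0: "k 0 = 0"
      and S: "\<And>x \<zeta>. real_vec x \<Longrightarrow> sqnorm x = 1 \<Longrightarrow> norm (L x) = 1 \<Longrightarrow> cmod \<zeta> < 1 \<Longrightarrow> k (\<zeta> *s x) = \<zeta> *s L x"
      and z: "z \<in> lie_ball" for k L :: "complex ^ 'n \<Rightarrow> complex ^ 'n" and z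
  proof (rule eq_if_eq_on_real_points[OF k _ _ z])
    show "holo_on L lie_ball"
      unfolding holo_on_componentwise using hol_at_clin[OF L, of "\<lambda>z. z"] by simp
    fix y :: "complex ^ 'n" assume y: "real_vec y" "y \<in> lie_ball"
    show "k y = L y"
    proof (cases "y = 0")
      case True
      then show ?thesis using k0 L by (simp add: clin_def linear_0)
    next
      case False
      \<comment> \<open>A nonzero real y is scaled to a real unit vector x. Since L is an isometry,
        |L x| = 1, which is the equality case of the Schwarz lemma.\<close>
      define r where "r = norm y"
      define x where "x = complex_of_real (1 / r) *s y"
      have r: "0 < r" "r < 1" using False norm_less_one_lie_ball[OF y(2)] by (auto simp: r_def)
      have yx: "y = complex_of_real r *s x" using r by (simp add: x_def vector_smult_assoc)
      have "norm x = 1" using r by (simp add: x_def norm_scale_complex norm_divide flip: r_def)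
      then have x: "real_vec x" "sqnorm x = 1"
        using y(1) by (auto simp: real_vec_def x_def sqnorm_eq_norm)
      have "norm (L x) = 1"
        using NL[of x] \<open>norm x = 1\<close> power2_eq_imp_eq[of "norm (L x)" 1] by (simp add: sqnorm_eq_norm)
      then have "k (complex_of_real r *s x) = complex_of_real r *s L x"
        using S[OF x, of "complex_of_real r"] r by simp
      then show ?thesis using L yx by (simp add: clin_def)
    qed
  qed
  have fA: "f z = A z" and gB: "g z = B z" if "z \<in> lie_ball" for z
    by (rule lin[OF f(1) A(2) NA f0 fS(2) that], assumption+)
      (rule lin[OF g(1) B(2) NB g0 gS(2) that], assumption+)
  have "cmod (qf z) \<le> cmod (qf (A z))" "cmod (qf z) \<le> cmod (qf (B z))" for z
    using qf_le_of_preserves_lie_ball[OF A(2) NA] qf_le_of_preserves_lie_ball[OF B(2) NB]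
      biholoD(1,2)[OF fg] fA gB by metis+
  then have "cmod (qf (A z)) = cmod (qf z)" for z by (metis BA order_antisym)
  then obtain \<kappa> where k: "cmod \<kappa> = 1" "\<And>z. qf (A z) = \<kappa> * qf z"
    using qf_proportional[OF A(2)] by blast
  obtain F G where F: "biholo LL F G" "\<And>z. z \<in> lie_ball \<Longrightarrow> F (embed0 z) = embed0 (A z)"
    using liftsE[OF lifts_linear[OF A(2) B(2) AB BA NA k(2,1)]] by metis
  show ?thesis
    by (rule liftsI[OF fg F(1)]) (simp add: F(2) fA)
qed

theorem theorem5p3:
  fixes h :: "complex ^ 'n::finite \<Rightarrow> complex ^ 'n"
  assumes "h \<in> aut (lie_ball :: (complex ^ 'n) set)"
  shows "\<exists>F \<in> aut (LL :: (complex ^ ('n option)) set).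
           \<forall>z \<in> (lie_ball :: (complex ^ 'n) set). F (embed0 z) = embed0 (h z)"
proof -
  obtain h' where h: "biholo lie_ball h h'" using aut_imp_biholo[OF assms] by blast
  \<comment> \<open>Here f carries h(0) back to the origin, so f after h fixes 0 and lifts;
    composing with the inverse g recovers h on the Lie ball.\<close>
  obtain f g where fg: "lifts f g" "f (h 0) = 0"
    using lie_ball_transitive[OF biholoD(1)[OF h zero_in_lie_ball]] by blast
  have "lifts (\<lambda>z. f (h z)) (\<lambda>z. h' (g z))"
    by (rule lifts_fixing_origin[OF biholo_compose[OF h lifts_biholo[OF fg(1)]] fg(2)])
  from lifts_compose[OF this lifts_sym[OF fg(1)]]
  obtain F G where F: "biholo LL F G" "\<And>z. z \<in> lie_ball \<Longrightarrow> F (embed0 z) = embed0 (g (f (h z)))"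
    using liftsE by metis
  have "g (f (h z)) = h z" if "z \<in> lie_ball" for z
    using biholoD(3)[OF lifts_biholo[OF fg(1)] biholoD(1)[OF h that]] .
  then have "\<forall>z\<in>lie_ball. F (embed0 z) = embed0 (h z)" using F(2) by simp
  then show ?thesis using biholo_imp_aut[OF F(1) open_LL] by blast
qed

end
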